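(* Let $u$ be the mild solution of the stochastic heat equation $u_t=u_{xx}+\dot W$ in $(0,T]\times D$, $u(t,\cdot)|_{\partial D}=0$ for $t\in(0,T]$, $u(0,\cdot)=0$ in $D$, and let $\widehat u$ be the solution of the regularized problem $\widehat u_t=\widehat u_{xx}+\mathcal W$ in $(0,T]\times D$, $\widehat u(t,\cdot)|_{\partial D}=0$ for $t\in(0,T]$, $\widehat u(0,\cdot)=0$ in $D$ (both as given in the context). For $t\in[0,T]$ set $\mathcal Z(t):=\left(\mathbb E\left[\|u(t,\cdot)-\widehat u(t,\cdot)\|_{L^2(D)}^2\right]\right)^{1/2}$. Then there exists a constant $C_{\rm ME}>0$, independent of $\Delta t$ and $\Delta x$, such that $$\max_{t\in[0,T]}\mathcal Z(t)\le C_{\rm ME}\left(\Delta t^{\frac14}+\epsilon^{-\frac12}\,\Delta x^{\frac12-\epsilon}\right)\qquad\forall\,\epsilon\in\left(0,\tfrac12\right].$$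
   Context: $T>0$ is fixed, $D=(0,1)$, $(\Omega,\mathcal F,P)$ is a complete probability space, $\mathbb E$ denotes expectation, and $\dot W$ is a space-time white noise on $[0,T]\times D$; $W$ denotes the associated Gaussian random measure ($W(S)\sim N(0,|S|)$, with $W(S_1),W(S_2)$ independent when $S_1\cap S_2=\varnothing$), and $\int\int\cdot\,dW$ is the corresponding (Walsh/Itô) stochastic integral. Let $\lambda_k:=k\pi$, $\varepsilon_k(z):=\sqrt2\sin(\lambda_k z)$ for $k\in\mathbb N$, and let $G_t(x,y):=\sum_{k=1}^\infty e^{-\lambda_k^2t}\varepsilon_k(x)\varepsilon_k(y)$ be the Dirichlet heat kernel on $D$. The mild solution is $u(t,x)=\int_0^t\int_D G_{t-s}(x,y)\,dW(s,y)$. For $N_\star,J_\star\in\mathbb N$ let $\Delta t:=T/N_\star$, $\Delta x:=1/J_\star$, $t_n:=n\Delta t$, $x_j:=j\Delta x$, $T_n:=(t_{n-1},t_n)$, $D_j:=(x_{j-1},x_j)$ for $n=1,\dots,N_\star$, $j=1,\dots,J_\star$. The piecewise constant stochastic load is $$\mathcal W:=\frac{1}{\Delta t\,\Delta x}\sum_{n=1}^{N_\star}\sum_{j=1}^{J_\star}W(T_n\times D_j)\,\mathcal X_{T_n\times D_j},$$ where $\mathcal X_A$ is the indicator function of $A$. The solution of the regularized problem is $\widehat u(t,x)=\int_0^t\int_D G_{t-s}(x,y)\,\mathcal W(s,y)\,dy\,ds$ for $(t,x)\in[0,T]\times\overline D$. *)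

theory Defs
  imports "HOL-Probability.Probability"
begin

definition eigval :: "nat \<Rightarrow> real" where
  "eigval k = real k * pi"

definition eigfun :: "nat \<Rightarrow> real \<Rightarrow> real" where
  "eigfun k z = sqrt 2 * sin (eigval k * z)"

text \<open>The series starts at index 1, hence the \<^term>\<open>Suc\<close>. It is only meaningful for
  positive times; time 0 is met below only on null sets.\<close>

definition heat_kernel :: "real \<Rightarrow> real \<Rightarrow> real \<Rightarrow> real" where
  "heat_kernel t x y =
     (\<Sum>k. exp (- ((eigval (Suc k))\<^sup>2 * t)) * eigfun (Suc k) x * eigfun (Suc k) y)"

definition spacetime :: "real \<Rightarrow> (real \<times> real) set" where
  "spacetime T = {0..T} \<times> {0<..<1}"

text \<open>Centred normal law of variance \<open>v\<close>; \<^const>\<open>normal_density\<close> is no density for \<open>v = 0\<close>,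
  where the law is the point mass at 0.\<close>

definition centered_gaussian :: "'a measure \<Rightarrow> ('a \<Rightarrow> real) \<Rightarrow> real \<Rightarrow> bool" where
  "centered_gaussian M X v \<longleftrightarrow>
     X \<in> borel_measurable M \<and> 0 \<le> v \<and>
     (if v = 0 then AE \<omega> in M. X \<omega> = 0
      else distributed M lborel X (normal_density 0 (sqrt v)))"

text \<open>Gaussian random measure on \<open>Q\<close> with Lebesgue measure as intensity. The second clause says
  that the family of all \<open>W A\<close> is jointly Gaussian. Additivity is required almost surely only, with
  an exceptional null set that depends on the sets; countable additivity in mean square follows from
  the variances.\<close>

definition white_noise ::
  "'a measure \<Rightarrow> (real \<times> real) set \<Rightarrow> ((real \<times> real) set \<Rightarrow> 'a \<Rightarrow> real) \<Rightarrow> bool" where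
  "white_noise M Q W \<longleftrightarrow>
     (\<forall>A\<in>sets borel. A \<subseteq> Q \<longrightarrow> centered_gaussian M (W A) (measure lborel A)) \<and>
     (\<forall>\<A> c. finite \<A> \<and> \<A> \<subseteq> sets borel \<and> (\<forall>A\<in>\<A>. A \<subseteq> Q) \<longrightarrow>
        (\<exists>v. centered_gaussian M (\<lambda>\<omega>. \<Sum>A\<in>\<A>. c A * W A \<omega>) v)) \<and>
     (\<forall>A\<in>sets borel. \<forall>B\<in>sets borel. A \<subseteq> Q \<and> B \<subseteq> Q \<and> A \<inter> B = {} \<longrightarrow>
        prob_space.indep_var M borel (W A) borel (W B) \<and>
        (AE \<omega> in M. W (A \<union> B) \<omega> = W A \<omega> + W B \<omega>))"

definition simple_wiener_integral ::
  "(real \<times> real) set \<Rightarrow> ((real \<times> real) set \<Rightarrow> 'a \<Rightarrow> real) \<Rightarrow> (real \<times> real \<Rightarrow> real) \<Rightarrow> 'a \<Rightarrow> real" where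
  "simple_wiener_integral Q W F \<omega> = (\<Sum>c\<in>F ` Q. c * W (F -` {c} \<inter> Q) \<omega>)"

text \<open>For deterministic integrands the Walsh integral is the extension of the integral of simple
  functions by mean square limits. It is determined only up to modification on null sets, so it is
  a relation: \<open>X\<close> is a version of the integral of \<open>f\<close> over \<open>Q\<close>. Square integrability of \<open>f\<close> on
  \<open>Q\<close> is implied when \<open>Q\<close> has finite measure.\<close>

definition has_wiener_integral ::
  "'a measure \<Rightarrow> (real \<times> real) set \<Rightarrow> ((real \<times> real) set \<Rightarrow> 'a \<Rightarrow> real) \<Rightarrow>
   (real \<times> real \<Rightarrow> real) \<Rightarrow> ('a \<Rightarrow> real) \<Rightarrow> bool" where
  "has_wiener_integral M Q W f X \<longleftrightarrow>
     X \<in> borel_measurable M \<and>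
     f \<in> borel_measurable (restrict_space lborel Q) \<and>
     (\<exists>F. (\<forall>n. simple_function (restrict_space lborel Q) (F n)) \<and>
          (\<lambda>n. \<integral>\<^sup>+ z. ennreal ((F n z - f z)\<^sup>2) \<partial>restrict_space lborel Q) \<longlonglongrightarrow> 0 \<and>
          (\<lambda>n. \<integral>\<^sup>+ \<omega>. ennreal ((simple_wiener_integral Q W (F n) \<omega> - X \<omega>)\<^sup>2) \<partial>M) \<longlonglongrightarrow> 0)"

text \<open>Each \<open>u t x\<close> is fixed by the stochastic integral only almost surely. The measurability clause
  selects a version for which the spatial norm of \<open>u t\<close> is a random variable.\<close>

definition mild_solution ::
  "'a measure \<Rightarrow> real \<Rightarrow> ((real \<times> real) set \<Rightarrow> 'a \<Rightarrow> real) \<Rightarrow> (real \<Rightarrow> real \<Rightarrow> 'a \<Rightarrow> real) \<Rightarrow> bool" where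
  "mild_solution M T W u \<longleftrightarrow>
     (\<forall>t\<in>{0..T}.
        (\<lambda>(x, \<omega>). u t x \<omega>) \<in> borel_measurable (restrict_space borel {0..1} \<Otimes>\<^sub>M M) \<and>
        (\<forall>x\<in>{0..1}. has_wiener_integral M (spacetime T) W
           (\<lambda>(s, y). indicator {0<..<t} s * heat_kernel (t - s) x y) (u t x)))"

definition cell :: "real \<Rightarrow> nat \<Rightarrow> nat \<Rightarrow> nat \<Rightarrow> nat \<Rightarrow> (real \<times> real) set" where
  "cell T N J n j =
     {real (n - 1) * (T / real N)<..<real n * (T / real N)} \<times>
     {real (j - 1) * (1 / real J)<..<real j * (1 / real J)}"

definition discrete_load ::
  "real \<Rightarrow> nat \<Rightarrow> nat \<Rightarrow> ((real \<times> real) set \<Rightarrow> 'a \<Rightarrow> real) \<Rightarrow> real \<Rightarrow> real \<Rightarrow> 'a \<Rightarrow> real" where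
  "discrete_load T N J W s y \<omega> =
     1 / ((T / real N) * (1 / real J)) *
     (\<Sum>n=1..N. \<Sum>j=1..J. W (cell T N J n j) \<omega> * indicator (cell T N J n j) (s, y))"

definition regularized_solution ::
  "real \<Rightarrow> nat \<Rightarrow> nat \<Rightarrow> ((real \<times> real) set \<Rightarrow> 'a \<Rightarrow> real) \<Rightarrow> real \<Rightarrow> real \<Rightarrow> 'a \<Rightarrow> real" where
  "regularized_solution T N J W t x \<omega> =
     (LINT s:{0<..<t}|lborel. LINT y:{0<..<1}|lborel.
        heat_kernel (t - s) x y * discrete_load T N J W s y \<omega>)"

definition ennsqrt :: "ennreal \<Rightarrow> ennreal" where
  "ennsqrt a = (if a = \<infinity> then \<infinity> else ennreal (sqrt (enn2real a)))"

text \<open>Expectation and spatial norm are nonnegative integrals with values in \<^typ>\<open>ennreal\<close>, so that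
  a finite bound on the error includes its square integrability.\<close>

definition modeling_error ::
  "'a measure \<Rightarrow> (real \<Rightarrow> real \<Rightarrow> 'a \<Rightarrow> real) \<Rightarrow> (real \<Rightarrow> real \<Rightarrow> 'a \<Rightarrow> real) \<Rightarrow> real \<Rightarrow> ennreal" where
  "modeling_error M u v t =
     ennsqrt (\<integral>\<^sup>+ \<omega>. (\<integral>\<^sup>+ x\<in>{0<..<1}. ennreal ((u t x \<omega> - v t x \<omega>)\<^sup>2) \<partial>lborel) \<partial>M)"

end

theory Submission
  imports Defs
begin

text \<open>
  Let \<open>f (s, y) = \<chi> (s) G\<^sub>t\<^sub>-\<^sub>s (x, y)\<close>, where \<open>\<chi>\<close> is the indicator function
  of \<open>(0, t)\<close>, be the integrand of the mild solution at \<open>(t, x)\<close>, and let \<open>P\<close> be the projection that replaces a function on the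
  space-time cylinder by its mean values over the cells. Exchanging the sum over the cells with the
  integral shows that the regularized solution is the stochastic integral of \<open>P f\<close>
  (\<open>regularized_solution_eq\<close>), so by the isometry of the Wiener integral
  (\<open>wiener_integral_isometry\<close>) the mean square error at \<open>x\<close> is the squared norm of \<open>f - P f\<close>.

  The kernel separates the variables: \<open>f\<close> is the sum over \<open>k\<close> of
  \<open>\<epsilon>\<^sub>k (x) h\<^sub>k (s) \<epsilon>\<^sub>k (y)\<close> with
  \<open>h\<^sub>k (s) = \<chi> (s) exp (- \<lambda>\<^sub>k\<^sup>2 (t - s))\<close>. For fixed \<open>(s, y)\<close> the
  difference \<open>f - P f\<close> is therefore a sine series in \<open>x\<close>, and Parseval's identity gives
  \<open>Z (t)\<^sup>2\<close> as the sum of the squared norms of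
  \<open>h\<^sub>k \<otimes> \<epsilon>\<^sub>k - P (h\<^sub>k \<otimes> \<epsilon>\<^sub>k)\<close> (\<open>mean_square_error_eq\<close>).
  As \<open>P\<close> is a tensor product of two one-dimensional orthogonal projections, each term is explicit
  (\<open>mode_error\<close>). It is continuous in \<open>t\<close> and at most \<open>1 / (2 \<lambda>\<^sub>k\<^sup>2)\<close>, so
  \<open>Z\<close> is continuous and attains its maximum.

  For the rate, \<open>h\<^sub>k\<close> has total variation at most 2, so that its squared projection error is at most
  \<open>4 \<Delta>t\<close> for every \<open>k\<close>; the squared projection error of \<open>\<epsilon>\<^sub>k\<close> is at most
  \<open>2 \<lambda>\<^sub>k\<^sup>2 \<Delta>x\<^sup>2\<close> by Lipschitz continuity. Together with the trivial bound, each term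
  is at most \<open>min (4 \<Delta>t) (1 / k\<^sup>2) + min (\<Delta>x\<^sup>2) (1 / k\<^sup>2)\<close>
  (\<open>mode_error_bounds\<close>). Since the sum of \<open>min (r\<^sup>2) (1 / k\<^sup>2)\<close> over \<open>k\<close> is at most
  \<open>\<pi> r\<close> (\<open>suminf_min_inverse_square_le\<close>), \<open>Z\<^sup>2\<close> is of order
  \<open>\<Delta>t\<^sup>1\<^sup>/\<^sup>2 + \<Delta>x\<close>, which is slightly more than claimed.
\<close>

section \<open>White noise and Wiener integrals\<close>

lemma (in prob_space) centered_gaussian_moments:
  assumes "centered_gaussian M X v"
  shows "integrable M X" "expectation X = 0"
    "integrable M (\<lambda>\<omega>. (X \<omega>)\<^sup>2)" "expectation (\<lambda>\<omega>. (X \<omega>)\<^sup>2) = v"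
proof -
  have X [measurable]: "X \<in> borel_measurable M" and v: "0 \<le> v"
    using assms by (auto simp: centered_gaussian_def)
  have "integrable M X \<and> expectation X = 0 \<and>
    integrable M (\<lambda>\<omega>. (X \<omega>)\<^sup>2) \<and> expectation (\<lambda>\<omega>. (X \<omega>)\<^sup>2) = v"
  proof (cases "v = 0")
    case True
    then have ae: "AE \<omega> in M. X \<omega> = 0"
      using assms by (simp add: centered_gaussian_def)
    then have ae2: "AE \<omega> in M. (X \<omega>)\<^sup>2 = 0"
      by auto
    have "has_bochner_integral M X 0" "has_bochner_integral M (\<lambda>\<omega>. (X \<omega>)\<^sup>2) 0"
      using has_bochner_integral_cong_AE[OF _ _ ae, of 0] has_bochner_integral_cong_AE[OF _ _ ae2, of 0]
      by (simp_all add: has_bochner_integral_zero)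
    then show ?thesis
      using True by (simp add: has_bochner_integral_iff)
  next
    case False
    then have s: "0 < sqrt v"
      using v by simp
    have D: "distributed M lborel X (normal_density 0 (sqrt v))"
      using assms False by (simp add: centered_gaussian_def)
    have i1: "integrable M X"
      using distributed_integrable[OF D, of "\<lambda>x. x"] integrable_normal_moment[OF s, of 0 1] by simp
    have e1: "expectation X = 0"
      by (rule normal_distributed_expectation[OF s D])
    have i2: "integrable M (\<lambda>\<omega>. (X \<omega>)\<^sup>2)"
      using distributed_integrable[OF D, of "\<lambda>x. x\<^sup>2"] integrable_normal_moment[OF s, of 0 2] by simp
    have "variance X = (sqrt v)\<^sup>2"
      by (rule normal_distributed_variance[OF s D])
    then show ?thesis
      using i1 e1 i2 v by simp
  qed
  then show "integrable M X" "expectation X = 0"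
    "integrable M (\<lambda>\<omega>. (X \<omega>)\<^sup>2)" "expectation (\<lambda>\<omega>. (X \<omega>)\<^sup>2) = v"
    by auto
qed

lemma white_noise_measurable:
  assumes "white_noise M Q W" "A \<in> sets borel" "A \<subseteq> Q"
  shows "W A \<in> borel_measurable M"
  using assms by (auto simp: white_noise_def centered_gaussian_def)

text \<open>Splitting \<open>A\<close> and \<open>B\<close> along \<open>A \<inter> B\<close> leaves only products of independent centred variables
  besides the square of \<open>W (A \<inter> B)\<close>.\<close>

lemma (in prob_space) white_noise_covariance:
  assumes W: "white_noise M Q W"
    and A: "A \<in> sets borel" "A \<subseteq> Q" and B: "B \<in> sets borel" "B \<subseteq> Q"
  shows "has_bochner_integral M (\<lambda>\<omega>. W A \<omega> * W B \<omega>) (measure lborel (A \<inter> B))"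
proof -
  have gauss: "centered_gaussian M (W S) (measure lborel S)" if "S \<in> sets borel" "S \<subseteq> Q" for S
    using W that by (auto simp: white_noise_def)
  have disj: "has_bochner_integral M (\<lambda>\<omega>. W S \<omega> * W S' \<omega>) 0"
    if S: "S \<in> sets borel" "S \<subseteq> Q" "S' \<in> sets borel" "S' \<subseteq> Q" "S \<inter> S' = {}" for S S'
  proof -
    have "indep_var borel (W S) borel (W S')"
      using W S by (simp add: white_noise_def)
    then show ?thesis
      using indep_var_lebesgue_integral[of "W S" "W S'"] indep_var_integrable[of "W S" "W S'"]
        centered_gaussian_moments[OF gauss[of S]] centered_gaussian_moments[OF gauss[of S']] S
      by (simp add: has_bochner_integral_iff)
  qed
  have add: "AE \<omega> in M. W (S \<union> S') \<omega> = W S \<omega> + W S' \<omega>"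
    if "S \<in> sets borel" "S' \<in> sets borel" "S \<subseteq> Q" "S' \<subseteq> Q" "S \<inter> S' = {}" for S S'
    using W that by (simp add: white_noise_def)
  have split: "AE \<omega> in M. W S \<omega> = W (S \<inter> S') \<omega> + W (S - S') \<omega>"
    if S: "S \<in> sets borel" "S \<subseteq> Q" "S' \<in> sets borel" "S' \<subseteq> Q" for S S'
  proof -
    have "AE \<omega> in M. W ((S \<inter> S') \<union> (S - S')) \<omega> = W (S \<inter> S') \<omega> + W (S - S') \<omega>"
      by (rule add) (use S in auto)
    moreover have "(S \<inter> S') \<union> (S - S') = S"
      by auto
    ultimately show ?thesis
      by simp
  qed
  let ?I = "A \<inter> B"
  have meas: "W S \<in> borel_measurable M" if "S \<in> sets borel" "S \<subseteq> Q" for S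
    using white_noise_measurable[OF W that] .
  have sub: "A \<inter> B \<subseteq> Q" "A - B \<subseteq> Q" "B - A \<subseteq> Q" "A \<inter> B \<in> sets borel" "A - B \<in> sets borel"
    "B - A \<in> sets borel"
    using A B by auto
  have "has_bochner_integral M (\<lambda>\<omega>. (W ?I \<omega>)\<^sup>2) (measure lborel ?I)"
    using centered_gaussian_moments[OF gauss[of ?I]] sub by (simp add: has_bochner_integral_iff)
  moreover have "has_bochner_integral M (\<lambda>\<omega>. W ?I \<omega> * W (B - A) \<omega>) 0"
    by (rule disj) (use sub in auto)
  moreover have "has_bochner_integral M (\<lambda>\<omega>. W (A - B) \<omega> * W ?I \<omega>) 0"
    by (rule disj) (use sub in auto)
  moreover have "has_bochner_integral M (\<lambda>\<omega>. W (A - B) \<omega> * W (B - A) \<omega>) 0"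
    by (rule disj) (use sub in auto)
  ultimately have "has_bochner_integral M (\<lambda>\<omega>. (W ?I \<omega>)\<^sup>2 + W ?I \<omega> * W (B - A) \<omega> +
      W (A - B) \<omega> * W ?I \<omega> + W (A - B) \<omega> * W (B - A) \<omega>) (measure lborel ?I + 0 + 0 + 0)"
    by (intro has_bochner_integral_add)
  then have main: "has_bochner_integral M (\<lambda>\<omega>. (W ?I \<omega>)\<^sup>2 + W ?I \<omega> * W (B - A) \<omega> +
      W (A - B) \<omega> * W ?I \<omega> + W (A - B) \<omega> * W (B - A) \<omega>) (measure lborel ?I)"
    by simp
  have "AE \<omega> in M. W A \<omega> * W B \<omega> = (W ?I \<omega>)\<^sup>2 + W ?I \<omega> * W (B - A) \<omega> +
      W (A - B) \<omega> * W ?I \<omega> + W (A - B) \<omega> * W (B - A) \<omega>"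
    using split[of A B] split[of B A] A B
    by (auto simp: Int_commute[of B A] power2_eq_square algebra_simps)
  then show ?thesis
    using main A B sub meas by (subst has_bochner_integral_cong_AE) auto
qed

text \<open>Both sides expand to the same quadratic form in the coefficients, because the covariance of
  the noise is the Gram matrix of the indicator functions. The sets may overlap, so the
  difference of two integrals of simple functions is covered as it stands.\<close>

lemma (in prob_space) white_noise_isometry:
  fixes c :: "'i \<Rightarrow> real"
  assumes W: "white_noise M Q W" and I: "finite I"
    and A: "\<And>i. i \<in> I \<Longrightarrow> A i \<in> sets borel" "\<And>i. i \<in> I \<Longrightarrow> A i \<subseteq> Q" and Q: "emeasure lborel Q < \<infinity>" "Q \<in> sets borel"
  shows "(\<integral>\<^sup>+ \<omega>. ennreal ((\<Sum>i\<in>I. c i * W (A i) \<omega>)\<^sup>2) \<partial>M) =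
    (\<integral>\<^sup>+ z. ennreal ((\<Sum>i\<in>I. c i * indicator (A i) z)\<^sup>2) \<partial>lborel)"
proof -
  let ?q = "\<Sum>i\<in>I. \<Sum>j\<in>I. c i * c j * measure lborel (A i \<inter> A j)"
  have sq: "(\<Sum>i\<in>I. c i * a i)\<^sup>2 = (\<Sum>i\<in>I. \<Sum>j\<in>I. c i * c j * (a i * a j))" for a :: "'i \<Rightarrow> real"
    by (simp add: power2_eq_square sum_product algebra_simps)
  have "has_bochner_integral M (\<lambda>\<omega>. (\<Sum>i\<in>I. c i * W (A i) \<omega>)\<^sup>2) ?q"
    unfolding sq
    by (intro has_bochner_integral_sum has_bochner_integral_mult_right white_noise_covariance[OF W])
       (use A in auto)
  then have 1: "(\<integral>\<^sup>+ \<omega>. ennreal ((\<Sum>i\<in>I. c i * W (A i) \<omega>)\<^sup>2) \<partial>M) = ennreal ?q"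
    by (simp add: has_bochner_integral_iff nn_integral_eq_integral)
  have ind: "has_bochner_integral lborel (\<lambda>z. indicator (A i) z * indicator (A j) z)
      (measure lborel (A i \<inter> A j))" if "i \<in> I" "j \<in> I" for i j
  proof -
    have "emeasure lborel (A i \<inter> A j) \<le> emeasure lborel Q"
      using A that Q by (intro emeasure_mono) auto
    then have "emeasure lborel (A i \<inter> A j) < \<infinity>"
      using Q by (auto intro: le_less_trans)
    then have "has_bochner_integral lborel (\<lambda>z. indicator (A i \<inter> A j) z :: real)
        (measure lborel (A i \<inter> A j))"
      using A that by (intro has_bochner_integral_real_indicator) auto
    then show ?thesis
      by (simp add: indicator_inter_arith)
  qed
  have "has_bochner_integral lborel (\<lambda>z. (\<Sum>i\<in>I. c i * indicator (A i) z)\<^sup>2) ?q"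
    unfolding sq
    by (intro has_bochner_integral_sum has_bochner_integral_mult_right ind)
  then have 2: "(\<integral>\<^sup>+ z. ennreal ((\<Sum>i\<in>I. c i * indicator (A i) z)\<^sup>2) \<partial>lborel) = ennreal ?q"
    by (simp add: has_bochner_integral_iff nn_integral_eq_integral)
  show ?thesis
    using 1 2 by simp
qed

text \<open>Young's inequality with a free weight \<open>d\<close>: the factor of the main term can be brought
  arbitrarily close to 1 while the perturbation still tends to 0.\<close>

lemma nn_integral_square_perturb:
  fixes X X' Y :: "'a \<Rightarrow> real"
  assumes [measurable]: "X \<in> borel_measurable M" "X' \<in> borel_measurable M" "Y \<in> borel_measurable M"
    and d: "0 < d"
  shows "(\<integral>\<^sup>+ \<omega>. ennreal ((X \<omega> - Y \<omega>)\<^sup>2) \<partial>M) \<le>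
    ennreal (1 + d) * (\<integral>\<^sup>+ \<omega>. ennreal ((X' \<omega> - Y \<omega>)\<^sup>2) \<partial>M) +
    ennreal (1 + 1 / d) * (\<integral>\<^sup>+ \<omega>. ennreal ((X' \<omega> - X \<omega>)\<^sup>2) \<partial>M)"
proof -
  have "(x - y)\<^sup>2 \<le> (1 + d) * (x' - y)\<^sup>2 + (1 + 1 / d) * (x' - x)\<^sup>2" for x x' y :: real
  proof -
    (* The difference of the two sides is this square. *)
    have "0 \<le> (d * (x' - y) + (x' - x))\<^sup>2 / d"
      using d by simp
    also have "\<dots> = (1 + d) * (x' - y)\<^sup>2 + (1 + 1 / d) * (x' - x)\<^sup>2 - (x - y)\<^sup>2"
      using d by (simp add: field_simps power2_eq_square)
    finally show ?thesis
      by simp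
  qed
  then have "ennreal ((x - y)\<^sup>2) \<le>
      ennreal (1 + d) * ennreal ((x' - y)\<^sup>2) + ennreal (1 + 1 / d) * ennreal ((x' - x)\<^sup>2)" for x x' y
    using d by (simp add: ennreal_mult'[symmetric] ennreal_plus[symmetric] del: ennreal_plus)
  then have "(\<integral>\<^sup>+ \<omega>. ennreal ((X \<omega> - Y \<omega>)\<^sup>2) \<partial>M) \<le>
    (\<integral>\<^sup>+ \<omega>. ennreal (1 + d) * ennreal ((X' \<omega> - Y \<omega>)\<^sup>2) + ennreal (1 + 1 / d) * ennreal ((X' \<omega> - X \<omega>)\<^sup>2) \<partial>M)"
    by (intro nn_integral_mono)
  then show ?thesis
    by (simp add: nn_integral_add nn_integral_cmult)
qed

text \<open>Both functions are approximated in mean square along sequences whose distances to \<open>Y\<close> and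
  \<open>g\<close> agree. Young's inequality in place of the triangle inequality keeps the argument valid
  when the integrals are infinite. Exchanging the roles of the two sides gives equality.\<close>

lemma nn_integral_square_le_of_approx:
  fixes X Y :: "'a \<Rightarrow> real" and f g :: "'b \<Rightarrow> real"
  assumes X: "X \<in> borel_measurable M" "\<And>n. X' n \<in> borel_measurable M" "Y \<in> borel_measurable M"
    and f: "f \<in> borel_measurable K" "\<And>n. f' n \<in> borel_measurable K" "g \<in> borel_measurable K"
    and limX: "(\<lambda>n::nat. \<integral>\<^sup>+ \<omega>. ennreal ((X' n \<omega> - X \<omega>)\<^sup>2) \<partial>M) \<longlonglongrightarrow> 0"
    and limf: "(\<lambda>n. \<integral>\<^sup>+ z. ennreal ((f' n z - f z)\<^sup>2) \<partial>K) \<longlonglongrightarrow> 0"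
    and iso: "\<And>n. (\<integral>\<^sup>+ \<omega>. ennreal ((X' n \<omega> - Y \<omega>)\<^sup>2) \<partial>M) = (\<integral>\<^sup>+ z. ennreal ((f' n z - g z)\<^sup>2) \<partial>K)"
  shows "(\<integral>\<^sup>+ \<omega>. ennreal ((X \<omega> - Y \<omega>)\<^sup>2) \<partial>M) \<le> (\<integral>\<^sup>+ z. ennreal ((f z - g z)\<^sup>2) \<partial>K)"
    (is "?A \<le> ?B")
proof -
  let ?eX = "\<lambda>n::nat. \<integral>\<^sup>+ \<omega>. ennreal ((X' n \<omega> - X \<omega>)\<^sup>2) \<partial>M"
  let ?ef = "\<lambda>n. \<integral>\<^sup>+ z. ennreal ((f' n z - f z)\<^sup>2) \<partial>K"
  have le: "?A \<le> ennreal ((1 + d)\<^sup>2) * ?B" if d: "0 < d" for d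
  proof -
    let ?c = "ennreal (1 + d)" and ?c' = "ennreal (1 + 1 / d)"
    have bound: "?A \<le> ?c * (?c * ?B + ?c' * ?ef n) + ?c' * ?eX n" for n
    proof -
      have "?A \<le> ?c * (\<integral>\<^sup>+ z. ennreal ((f' n z - g z)\<^sup>2) \<partial>K) + ?c' * ?eX n"
        using nn_integral_square_perturb[OF X(1) X(2)[of n] X(3) d] unfolding iso .
      also have "\<dots> \<le> ?c * (?c * ?B + ?c' * (\<integral>\<^sup>+ z. ennreal ((f z - f' n z)\<^sup>2) \<partial>K)) + ?c' * ?eX n"
        by (intro add_right_mono mult_left_mono nn_integral_square_perturb f d) auto
      finally show ?thesis
        by (simp only: power2_commute[of "f _"])
    qed
    have lim: "(\<lambda>n. ?c * (?c * ?B + ?c' * ?ef n) + ?c' * ?eX n) \<longlonglongrightarrow>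
        ?c * (?c * ?B + ?c' * 0) + ?c' * 0"
      by (intro tendsto_add ennreal_tendsto_cmult limX limf tendsto_const) auto
    have "?A \<le> ?c * (?c * ?B + ?c' * 0) + ?c' * 0"
      by (rule LIMSEQ_le_const[OF lim]) (use bound in blast)
    also have "\<dots> = ennreal ((1 + d)\<^sup>2) * ?B"
      using d by (simp add: power2_eq_square ennreal_mult' mult.assoc)
    finally show ?thesis .
  qed
  show ?thesis
  proof (cases "?B = \<infinity>")
    case False
    have "(\<lambda>n. (1 + 1 / real (Suc n))\<^sup>2) \<longlonglongrightarrow> (1 + 0)\<^sup>2"
      by (intro tendsto_intros LIMSEQ_inverse_real_of_nat[unfolded inverse_eq_divide])
    then have "(\<lambda>n. ?B * ennreal ((1 + 1 / real (Suc n))\<^sup>2)) \<longlonglongrightarrow> ?B * ennreal ((1 + 0)\<^sup>2)"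
      using False by (intro ennreal_tendsto_cmult tendsto_ennrealI) (auto simp: top.not_eq_extremum)
    moreover have "?A \<le> ?B * ennreal ((1 + 1 / real (Suc n))\<^sup>2)" for n
      using le[of "1 / real (Suc n)"] by (simp only: mult.commute) simp
    ultimately have "?A \<le> ?B * ennreal ((1 + 0)\<^sup>2)"
      by (intro LIMSEQ_le_const) auto
    then show ?thesis
      by simp
  qed simp
qed

text \<open>The Walsh integral and a finite linear combination of values of the noise: the isometry passes
  from the approximating simple functions to the limit in both directions.\<close>

lemma (in prob_space) wiener_integral_isometry:
  fixes c :: "'i \<Rightarrow> real"
  assumes W: "white_noise M Q W" and X: "has_wiener_integral M Q W f X"
    and I: "finite I" and A: "\<And>i. i \<in> I \<Longrightarrow> A i \<in> sets borel" "\<And>i. i \<in> I \<Longrightarrow> A i \<subseteq> Q"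
    and Q: "emeasure lborel Q < \<infinity>" "Q \<in> sets borel"
  shows "(\<integral>\<^sup>+ \<omega>. ennreal ((X \<omega> - (\<Sum>i\<in>I. c i * W (A i) \<omega>))\<^sup>2) \<partial>M) =
    (\<integral>\<^sup>+ z. ennreal ((f z - (\<Sum>i\<in>I. c i * indicator (A i) z))\<^sup>2) \<partial>restrict_space lborel Q)"
proof -
  let ?K = "restrict_space lborel Q"
  let ?Y = "\<lambda>\<omega>. \<Sum>i\<in>I. c i * W (A i) \<omega>"
  let ?g = "\<lambda>z. \<Sum>i\<in>I. c i * indicator (A i) z"
  obtain F where F: "\<And>n. simple_function ?K (F n)"
    and limf: "(\<lambda>n. \<integral>\<^sup>+ z. ennreal ((F n z - f z)\<^sup>2) \<partial>?K) \<longlonglongrightarrow> 0"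
    and limX: "(\<lambda>n. \<integral>\<^sup>+ \<omega>. ennreal ((simple_wiener_integral Q W (F n) \<omega> - X \<omega>)\<^sup>2) \<partial>M) \<longlonglongrightarrow> 0"
    and mX: "X \<in> borel_measurable M" and mf: "f \<in> borel_measurable ?K"
    using X unfolding has_wiener_integral_def by auto
  have spK: "space ?K = Q"
    by (simp add: space_restrict_space)
  have level: "F n -` {c} \<inter> Q \<in> sets borel" for n c
  proof -
    have "F n -` {c} \<inter> Q \<in> sets ?K"
      using simple_functionD(2)[OF F[of n], of "{c}"] spK by simp
    then show ?thesis
      using Q by (auto simp: sets_restrict_space_iff)
  qed
  have finF: "finite (F n ` Q)" for n
    using simple_functionD(1)[OF F[of n]] spK by simp
  have mW: "W S \<in> borel_measurable M" if "S \<in> sets borel" "S \<subseteq> Q" for S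
    using white_noise_measurable[OF W that] .
  have mS: "simple_wiener_integral Q W (F n) \<in> borel_measurable M" for n
    unfolding simple_wiener_integral_def[abs_def]
    by (intro borel_measurable_sum borel_measurable_times borel_measurable_const mW level) auto
  have mY: "?Y \<in> borel_measurable M"
    by (intro borel_measurable_sum borel_measurable_times borel_measurable_const mW A)
  have mg: "?g \<in> borel_measurable ?K"
    by (intro borel_measurable_sum borel_measurable_times borel_measurable_const measurable_restrict_space1
        borel_measurable_indicator) (use A in auto)
  have mF: "F n \<in> borel_measurable ?K" for n
    by (rule borel_measurable_simple_function[OF F])
  have iso: "(\<integral>\<^sup>+ \<omega>. ennreal ((simple_wiener_integral Q W (F n) \<omega> - ?Y \<omega>)\<^sup>2) \<partial>M) =
      (\<integral>\<^sup>+ z. ennreal ((F n z - ?g z)\<^sup>2) \<partial>?K)" for n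
  proof -
    (* The difference is a linear combination indexed by the disjoint union of the levels of F n
       and of I, with a minus sign on the second part. *)
    let ?J = "F n ` Q <+> I"
    let ?A = "case_sum (\<lambda>c. F n -` {c} \<inter> Q) A"
    let ?c = "case_sum (\<lambda>c. c) (\<lambda>i. - c i)"
    have AJ: "?A j \<in> sets borel" "?A j \<subseteq> Q" if "j \<in> ?J" for j
      using that A(1) A(2)[THEN subsetD] level by auto
    have L: "simple_wiener_integral Q W (F n) \<omega> - ?Y \<omega> = (\<Sum>j\<in>?J. ?c j * W (?A j) \<omega>)" for \<omega>
      using finF[of n] I by (simp add: sum.Plus simple_wiener_integral_def sum_negf)
    have R: "(F n z - ?g z) * indicator Q z = (\<Sum>j\<in>?J. ?c j * indicator (?A j) z)" for z
    proof (cases "z \<in> Q")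
      case True
      have "(\<Sum>c\<in>F n ` Q. c * indicator (F n -` {c} \<inter> Q) z) = (\<Sum>c\<in>F n ` Q. if c = F n z then c else 0)"
        using True by (intro sum.cong) (auto simp: indicator_def)
      also have "\<dots> = F n z"
        using True finF[of n] by simp
      finally have "(\<Sum>j\<in>?J. ?c j * indicator (?A j) z) = F n z - ?g z"
        by (simp only: sum.Plus[OF finF I] o_def sum.case sum_negf mult_minus_left)
      then show ?thesis
        using True by (simp only: indicator_simps mult_1_right)
    next
      case False
      then have "z \<notin> ?A j" if "j \<in> ?J" for j
        using AJ(2)[OF that] by auto
      then show ?thesis
        using False by (simp add: indicator_def)
    qed
    have sqR: "ennreal ((F n z - ?g z)\<^sup>2) * indicator Q z = ennreal ((\<Sum>j\<in>?J. ?c j * indicator (?A j) z)\<^sup>2)" for z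
      unfolding R[symmetric] by (simp add: indicator_def)
    have "(\<integral>\<^sup>+ z. ennreal ((F n z - ?g z)\<^sup>2) \<partial>?K) =
        (\<integral>\<^sup>+ z. ennreal ((\<Sum>j\<in>?J. ?c j * indicator (?A j) z)\<^sup>2) \<partial>lborel)"
      using Q by (subst nn_integral_restrict_space) (simp_all add: sqR)
    also have "\<dots> = (\<integral>\<^sup>+ \<omega>. ennreal ((\<Sum>j\<in>?J. ?c j * W (?A j) \<omega>)\<^sup>2) \<partial>M)"
      by (rule white_noise_isometry[symmetric, OF W]) (use AJ finF I Q in auto)
    finally show ?thesis
      by (simp only: L)
  qed
  show ?thesis
  proof (rule antisym)
    show "(\<integral>\<^sup>+ \<omega>. ennreal ((X \<omega> - ?Y \<omega>)\<^sup>2) \<partial>M) \<le> (\<integral>\<^sup>+ z. ennreal ((f z - ?g z)\<^sup>2) \<partial>?K)"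
      by (rule nn_integral_square_le_of_approx[OF mX mS mY mf mF mg limX limf iso])
    show "(\<integral>\<^sup>+ z. ennreal ((f z - ?g z)\<^sup>2) \<partial>?K) \<le> (\<integral>\<^sup>+ \<omega>. ennreal ((X \<omega> - ?Y \<omega>)\<^sup>2) \<partial>M)"
      by (rule nn_integral_square_le_of_approx[OF mf mF mg mX mS mY limf limX iso[symmetric]])
  qed
qed

section \<open>Projection onto step functions on a uniform grid\<close>

abbreviation ivl_measure :: "real \<Rightarrow> real measure" where
  "ivl_measure L \<equiv> restrict_space lborel {0<..<L}"

definition grid_cell :: "real \<Rightarrow> nat \<Rightarrow> nat \<Rightarrow> real set" where
  "grid_cell L m i = {real (i - 1) * (L / real m)<..<real i * (L / real m)}"

definition cell_avg :: "real \<Rightarrow> nat \<Rightarrow> (real \<Rightarrow> real) \<Rightarrow> nat \<Rightarrow> real" where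
  "cell_avg L m g i = (LINT s:grid_cell L m i|lborel. g s) / (L / real m)"

definition step_proj :: "real \<Rightarrow> nat \<Rightarrow> (real \<Rightarrow> real) \<Rightarrow> real \<Rightarrow> real" where
  "step_proj L m g s = (\<Sum>i=1..m. cell_avg L m g i * indicator (grid_cell L m i) s)"

text \<open>The squared norm of \<^term>\<open>step_proj L m g\<close> on \<open>(0, L)\<close>.\<close>

definition proj_energy :: "real \<Rightarrow> nat \<Rightarrow> (real \<Rightarrow> real) \<Rightarrow> real" where
  "proj_energy L m g = L / real m * (\<Sum>i=1..m. (cell_avg L m g i)\<^sup>2)"

lemma grid_cell_measurable [measurable]: "grid_cell L m i \<in> sets borel"
  by (simp add: grid_cell_def)

lemma grid_cell_subset:
  assumes "0 < L" "i \<in> {1..m}"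
  shows "grid_cell L m i \<subseteq> {0<..<L}"
proof
  fix s assume s: "s \<in> grid_cell L m i"
  have m: "0 < real m"
    using assms by auto
  have "0 \<le> real (i - 1) * (L / real m)"
    using assms by simp
  moreover have "real i * (L / real m) \<le> L"
    using assms m by (simp add: field_simps)
  ultimately show "s \<in> {0<..<L}"
    using s by (auto simp: grid_cell_def)
qed

lemma grid_cell_unique:
  assumes "0 < L" "i \<in> {1..m}" "j \<in> {1..m}" "s \<in> grid_cell L m i" "s \<in> grid_cell L m j"
  shows "i = j"
proof -
  have d: "0 < L / real m"
    using assms by auto
  have "\<not> i < j" if "s \<in> grid_cell L m i" "s \<in> grid_cell L m j" for i j
  proof
    assume "i < j"
    then have "real i * (L / real m) \<le> real (j - 1) * (L / real m)"
      using d by (intro mult_right_mono) auto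
    then show False
      using that by (auto simp: grid_cell_def)
  qed
  then show ?thesis
    using assms by (meson linorder_neqE_nat)
qed

text \<open>The open cells miss only the finitely many grid points.\<close>

lemma AE_in_grid_cell:
  assumes "0 < L" "1 \<le> m"
  shows "AE s in lborel. s \<in> {0<..<L} \<longrightarrow> (\<exists>i\<in>{1..m}. s \<in> grid_cell L m i)"
proof -
  let ?d = "L / real m"
  have d: "0 < ?d"
    using assms by auto
  have "AE s in lborel. s \<notin> (\<lambda>i. real i * ?d) ` {0..m}"
    by (intro AE_not_in finite_imp_null_set_lborel) simp
  then show ?thesis
  proof eventually_elim
    case (elim s)
    show ?case
    proof
      assume s: "s \<in> {0<..<L}"
      define i where "i = nat \<lfloor>s / ?d\<rfloor>"
      have pos: "0 \<le> s / ?d"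
        using s d by simp
      have i: "real i \<le> s / ?d" "s / ?d < real i + 1"
        using pos by (auto simp: i_def of_nat_nat)
      have "s < real m * ?d"
        using s assms by simp
      then have "s / ?d < real m"
        by (simp only: pos_divide_less_eq[OF d])
      then have "real i < real m"
        using i(1) by linarith
      then have im: "i < m"
        by simp
      have lo: "real i * ?d \<le> s"
        using i(1) pos_le_divide_eq[OF d] by simp
      have hi: "s < (real i + 1) * ?d"
        using i(2) pos_divide_less_eq[OF d] by simp
      have "real i * ?d \<noteq> s"
        using elim im by (auto simp: image_iff)
      then have "s \<in> grid_cell L m (Suc i)"
        using lo hi by (simp add: grid_cell_def add.commute)
      then show "\<exists>i\<in>{1..m}. s \<in> grid_cell L m i"
        using im by (intro bexI[of _ "Suc i"]) auto
    qed
  qed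
qed

lemma measure_grid_cell:
  assumes "0 < L" "i \<in> {1..m}"
  shows "measure lborel (grid_cell L m i) = L / real m"
proof -
  obtain k where i: "i = Suc k"
    using assms by (cases i) auto
  define d where "d = L / real m"
  have "0 \<le> d"
    using assms by (simp add: d_def)
  then show ?thesis
    unfolding grid_cell_def i d_def[symmetric] by (simp add: distrib_right)
qed

lemma finite_measure_ivl: "finite_measure (restrict_space lborel {a<..<b::real})"
  by (rule finite_measureI, cases "a \<le> b") (simp_all add: emeasure_restrict_space space_restrict_space)

lemma integrable_ivl_bounded:
  fixes g :: "real \<Rightarrow> real"
  assumes "g \<in> borel_measurable borel" "\<And>s. \<bar>g s\<bar> \<le> B"
  shows "integrable (restrict_space lborel {a<..<b}) g"
proof -
  interpret finite_measure "restrict_space lborel {a<..<b}"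
    by (rule finite_measure_ivl)
  show ?thesis
    using assms by (intro integrable_const_bound[of _ B]) (auto intro!: measurable_restrict_space1)
qed

lemma integrable_ivl_bounded_mult:
  fixes g h :: "real \<Rightarrow> real"
  assumes "g \<in> borel_measurable borel" "\<And>s. \<bar>g s\<bar> \<le> B" "h \<in> borel_measurable borel" "\<And>s. \<bar>h s\<bar> \<le> B'"
  shows "integrable (restrict_space lborel {a<..<b}) (\<lambda>s. g s * h s)"
proof (rule integrable_ivl_bounded)
  show "\<bar>g s * h s\<bar> \<le> B * B'" for s
    unfolding abs_mult using assms by (intro mult_mono) (auto intro: order_trans[OF abs_ge_zero])
qed (use assms in measurable)

lemma step_proj_measurable [measurable]: "step_proj L m g \<in> borel_measurable borel"
  unfolding step_proj_def[abs_def] by measurable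

lemma step_proj_bounded: "\<bar>step_proj L m g s\<bar> \<le> (\<Sum>i=1..m. \<bar>cell_avg L m g i\<bar>)"
  unfolding step_proj_def by (rule order_trans[OF sum_abs]) (auto intro!: sum_mono simp: indicator_def)

lemma step_proj_on_cell:
  assumes "0 < L" "i \<in> {1..m}" "s \<in> grid_cell L m i"
  shows "step_proj L m g s = cell_avg L m g i"
proof -
  have "step_proj L m g s = (\<Sum>j=1..m. if j = i then cell_avg L m g j else 0)"
    unfolding step_proj_def
  proof (intro sum.cong refl)
    fix j assume j: "j \<in> {1..m}"
    show "cell_avg L m g j * indicator (grid_cell L m j) s = (if j = i then cell_avg L m g j else 0)"
      using grid_cell_unique[OF assms(1) assms(2) j assms(3)] assms(3) by (cases "j = i") (auto simp: indicator_def)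
  qed
  then show ?thesis
    using assms(2) by simp
qed

lemma LINT_ivl_indicator_cell:
  assumes "0 < L" "i \<in> {1..m}"
  shows "(LINT s|ivl_measure L. g s * indicator (grid_cell L m i) s) = L / real m * cell_avg L m g i"
proof -
  have "(LINT s|ivl_measure L. g s * indicator (grid_cell L m i) s) =
      (LINT s|lborel. indicator {0<..<L} s *\<^sub>R (g s * indicator (grid_cell L m i) s))"
    by (subst integral_restrict_space) auto
  also have "\<dots> = (LINT s:grid_cell L m i|lborel. g s)"
    unfolding set_lebesgue_integral_def using grid_cell_subset[OF assms]
    by (intro Bochner_Integration.integral_cong) (auto simp: indicator_def)
  also have "\<dots> = L / real m * cell_avg L m g i"
    using assms by (simp add: cell_avg_def)
  finally show ?thesis .
qed

text \<open>\<^const>\<open>step_proj\<close> is the orthogonal projection onto the step functions of the grid: both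
  inner products reduce to integrals over single cells, which only see the mean value there.\<close>

lemma step_proj_inner:
  assumes g: "g \<in> borel_measurable borel" "\<And>s. \<bar>g s\<bar> \<le> B" and L: "0 < L"
  shows "has_bochner_integral (ivl_measure L) (\<lambda>s. g s * step_proj L m g s) (proj_energy L m g)"
    and "has_bochner_integral (ivl_measure L) (\<lambda>s. (step_proj L m g s)\<^sup>2) (proj_energy L m g)"
proof -
  let ?p = "step_proj L m g" and ?a = "cell_avg L m g"
  let ?B = "\<Sum>i=1..m. \<bar>?a i\<bar>"
  have gen: "has_bochner_integral (ivl_measure L) (\<lambda>s. h s * ?p s) (proj_energy L m g)"
    if h: "h \<in> borel_measurable borel" "\<And>s. \<bar>h s\<bar> \<le> B'"
      and avg: "\<And>i. i \<in> {1..m} \<Longrightarrow> (LINT s|ivl_measure L. h s * indicator (grid_cell L m i) s) = L / real m * ?a i"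
    for h B'
  proof -
    have "has_bochner_integral (ivl_measure L) (\<lambda>s. \<Sum>i=1..m. ?a i * (h s * indicator (grid_cell L m i) s))
      (\<Sum>i=1..m. ?a i * (L / real m * ?a i))"
    proof (intro has_bochner_integral_sum has_bochner_integral_mult_right)
      fix i assume i: "i \<in> {1..m}"
      have "integrable (ivl_measure L) (\<lambda>s. h s * indicator (grid_cell L m i) s)"
        by (rule integrable_ivl_bounded_mult[OF h, of _ 1]) (auto simp: indicator_def)
      then show "has_bochner_integral (ivl_measure L) (\<lambda>s. h s * indicator (grid_cell L m i) s) (L / real m * ?a i)"
        using avg[OF i] by (simp add: has_bochner_integral_iff)
    qed
    moreover have "(\<lambda>s. \<Sum>i=1..m. ?a i * (h s * indicator (grid_cell L m i) s)) = (\<lambda>s. h s * ?p s)"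
      by (simp only: step_proj_def sum_distrib_left ac_simps)
    moreover have "(\<Sum>i=1..m. ?a i * (L / real m * ?a i)) = proj_energy L m g"
      by (simp only: proj_energy_def sum_distrib_left power2_eq_square ac_simps)
    ultimately show ?thesis
      by simp
  qed
  show "has_bochner_integral (ivl_measure L) (\<lambda>s. g s * ?p s) (proj_energy L m g)"
    by (rule gen[OF g LINT_ivl_indicator_cell[OF L]])
  have "has_bochner_integral (ivl_measure L) (\<lambda>s. ?p s * ?p s) (proj_energy L m g)"
  proof (rule gen[OF step_proj_measurable step_proj_bounded])
    fix i assume i: "i \<in> {1..m}"
    have "(LINT s|ivl_measure L. ?p s * indicator (grid_cell L m i) s) =
        (LINT s|ivl_measure L. ?a i * indicator (grid_cell L m i) s)"
      using step_proj_on_cell[OF L i] by (intro Bochner_Integration.integral_cong) (auto simp: indicator_def)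
    also have "\<dots> = L / real m * cell_avg L m (\<lambda>_. ?a i) i"
      using LINT_ivl_indicator_cell[OF L i, of "\<lambda>_. ?a i"] by simp
    also have "cell_avg L m (\<lambda>_. ?a i) i = ?a i"
    proof -
      have "0 < L" "0 < real m"
        using L i by auto
      then show ?thesis
        using measure_grid_cell[OF L i] unfolding cell_avg_def[of _ _ "\<lambda>_. _"] set_lebesgue_integral_def by simp
    qed
    finally show "(LINT s|ivl_measure L. ?p s * indicator (grid_cell L m i) s) = L / real m * ?a i" .
  qed
  then show "has_bochner_integral (ivl_measure L) (\<lambda>s. (?p s)\<^sup>2) (proj_energy L m g)"
    by (simp add: power2_eq_square)
qed

lemma proj_energy_nonneg: "0 < L \<Longrightarrow> 0 \<le> proj_energy L m g"
  unfolding proj_energy_def by (intro mult_nonneg_nonneg sum_nonneg) auto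

lemma step_proj_error_sq:
  assumes g: "g \<in> borel_measurable borel" "\<And>s. \<bar>g s\<bar> \<le> B" and L: "0 < L"
  shows "has_bochner_integral (ivl_measure L) (\<lambda>s. (g s - step_proj L m g s)\<^sup>2)
    ((LINT s|ivl_measure L. (g s)\<^sup>2) - proj_energy L m g)"
proof -
  have "integrable (ivl_measure L) (\<lambda>s. (g s)\<^sup>2)"
    using integrable_ivl_bounded_mult[OF g g] by (simp add: power2_eq_square)
  then have "has_bochner_integral (ivl_measure L)
      (\<lambda>s. (g s)\<^sup>2 - 2 * (g s * step_proj L m g s) + (step_proj L m g s)\<^sup>2)
      ((LINT s|ivl_measure L. (g s)\<^sup>2) - 2 * proj_energy L m g + proj_energy L m g)"
    using step_proj_inner[OF g L]
    by (intro has_bochner_integral_add has_bochner_integral_diff has_bochner_integral_mult_right)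
       (auto simp: has_bochner_integral_iff)
  then show ?thesis
    by (simp add: power2_diff algebra_simps)
qed

lemma proj_energy_le:
  assumes g: "g \<in> borel_measurable borel" "\<And>s. \<bar>g s\<bar> \<le> B" and L: "0 < L"
  shows "proj_energy L m g \<le> (LINT s|ivl_measure L. (g s)\<^sup>2)"
proof -
  have "0 \<le> (LINT s|ivl_measure L. (g s - step_proj L m g s)\<^sup>2)"
    by (simp add: integral_nonneg_AE)
  then show ?thesis
    unfolding step_proj_error_sq[OF assms, of m, THEN has_bochner_integral_integral_eq] by simp
qed

text \<open>On each cell the function differs from its mean value by at most its oscillation.\<close>

lemma step_proj_error_le_oscillation:
  assumes g: "g \<in> borel_measurable borel" "\<And>s. \<bar>g s\<bar> \<le> B" and L: "0 < L" and m: "1 \<le> m"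
    and osc: "\<And>i s s'. i \<in> {1..m} \<Longrightarrow> s \<in> grid_cell L m i \<Longrightarrow> s' \<in> grid_cell L m i \<Longrightarrow> \<bar>g s - g s'\<bar> \<le> D i"
  shows "(LINT s|ivl_measure L. (g s)\<^sup>2) - proj_energy L m g \<le> L / real m * (\<Sum>i=1..m. (D i)\<^sup>2)"
proof -
  let ?d = "L / real m"
  let ?p = "step_proj L m g"
  have d: "0 < ?d"
    using L m by auto
  have local_bound: "\<bar>g s - cell_avg L m g i\<bar> \<le> D i" if i: "i \<in> {1..m}" and s: "s \<in> grid_cell L m i" for i s
  proof -
    let ?U = "restrict_space lborel (grid_cell L m i)"
    have avg: "cell_avg L m g i = (LINT x|?U. g x) / ?d"
      unfolding cell_avg_def set_lebesgue_integral_def by (subst integral_restrict_space) auto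
    have const: "(LINT x|?U. c) = ?d * c" for c :: real
      using measure_grid_cell[OF L i] by (simp add: measure_restrict_space space_restrict_space)
    have int: "integrable ?U g"
      unfolding grid_cell_def by (rule integrable_ivl_bounded[OF g])
    have intc: "integrable ?U (\<lambda>_. c)" for c :: real
      unfolding grid_cell_def by (rule integrable_ivl_bounded[of _ "\<bar>c\<bar>"]) auto
    have sp: "x \<in> grid_cell L m i" if "x \<in> space ?U" for x
      using that by (simp add: space_restrict_space)
    have "(LINT x|?U. g x) \<le> (LINT x|?U. g s + D i)"
      using osc[OF i _ s] sp by (intro integral_mono int intc) (force simp: abs_le_iff)
    then have up: "cell_avg L m g i \<le> g s + D i"
      unfolding avg const by (simp only: pos_divide_le_eq[OF d] mult.commute)
    have "(LINT x|?U. g s - D i) \<le> (LINT x|?U. g x)"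
      using osc[OF i s] sp by (intro integral_mono int intc) (force simp: abs_le_iff)
    then have "g s - D i \<le> cell_avg L m g i"
      unfolding avg const by (simp only: pos_le_divide_eq[OF d] mult.commute)
    then show ?thesis
      using up by linarith
  qed
  have "(LINT s|ivl_measure L. (g s)\<^sup>2) - proj_energy L m g = (LINT s|ivl_measure L. (g s - ?p s)\<^sup>2)"
    using step_proj_error_sq[OF g L] by (simp add: has_bochner_integral_iff)
  also have "\<dots> \<le> (LINT s|ivl_measure L. (\<Sum>i=1..m. (D i)\<^sup>2 * indicator (grid_cell L m i) s))"
  proof (rule integral_mono_AE)
    show "integrable (ivl_measure L) (\<lambda>s. (g s - ?p s)\<^sup>2)"
      using step_proj_error_sq[OF g L] by (simp add: has_bochner_integral_iff)
    show "integrable (ivl_measure L) (\<lambda>s. \<Sum>i=1..m. (D i)\<^sup>2 * indicator (grid_cell L m i) s)"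
      by (intro Bochner_Integration.integrable_sum integrable_mult_right integrable_ivl_bounded[of _ 1])
         (auto simp: indicator_def)
    have "AE s in lborel. s \<in> {0<..<L} \<longrightarrow> (g s - ?p s)\<^sup>2 \<le> (\<Sum>i=1..m. (D i)\<^sup>2 * indicator (grid_cell L m i) s)"
      using AE_in_grid_cell[OF L m]
    proof eventually_elim
      case (elim s)
      show ?case
      proof
        assume "s \<in> {0<..<L}"
        then obtain i where i: "i \<in> {1..m}" "s \<in> grid_cell L m i"
          using elim by auto
        have "(g s - ?p s)\<^sup>2 \<le> (D i)\<^sup>2"
          using local_bound[OF i] step_proj_on_cell[OF L i] by (metis abs_ge_zero power2_abs power_mono)
        also have "\<dots> = (D i)\<^sup>2 * indicator (grid_cell L m i) s"
          using i by simp
        also have "\<dots> \<le> (\<Sum>i=1..m. (D i)\<^sup>2 * indicator (grid_cell L m i) s)"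
          using i by (intro member_le_sum) auto
        finally show "(g s - ?p s)\<^sup>2 \<le> (\<Sum>i=1..m. (D i)\<^sup>2 * indicator (grid_cell L m i) s)" .
      qed
    qed
    then show "AE s in ivl_measure L. (g s - ?p s)\<^sup>2 \<le> (\<Sum>i=1..m. (D i)\<^sup>2 * indicator (grid_cell L m i) s)"
      by (subst AE_restrict_space_iff) auto
  qed
  also have "\<dots> = (\<Sum>i=1..m. (D i)\<^sup>2 * ?d)"
  proof -
    have "has_bochner_integral (ivl_measure L) (\<lambda>s. indicator (grid_cell L m i) s :: real) ?d" if i: "i \<in> {1..m}" for i
    proof -
      have "integrable (ivl_measure L) (\<lambda>s. indicator (grid_cell L m i) s :: real)"
        by (intro integrable_ivl_bounded[of _ 1]) (auto simp: indicator_def)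
      moreover have "(LINT s|ivl_measure L. indicator (grid_cell L m i) s :: real) = ?d"
        using LINT_ivl_indicator_cell[OF L i, of "\<lambda>_. 1"] measure_grid_cell[OF L i] d
        by (simp add: cell_avg_def set_lebesgue_integral_def)
      ultimately show ?thesis
        by (simp only: has_bochner_integral_iff)
    qed
    then have "has_bochner_integral (ivl_measure L) (\<lambda>s. \<Sum>i=1..m. (D i)\<^sup>2 * indicator (grid_cell L m i) s)
        (\<Sum>i=1..m. (D i)\<^sup>2 * ?d)"
      by (intro has_bochner_integral_sum has_bochner_integral_mult_right)
    then show ?thesis
      by (rule has_bochner_integral_integral_eq)
  qed
  also have "\<dots> = ?d * (\<Sum>i=1..m. (D i)\<^sup>2)"
    by (simp only: sum_distrib_left mult.commute)
  finally show ?thesis .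
qed

text \<open>A product minus the product of the projections: the cross terms collapse because
  the hypotheses say that \<open>p\<close> and \<open>q\<close> behave like orthogonal projections of \<open>g\<close>
  and \<open>e\<close>.\<close>

lemma nn_integral_tensor_projection_error:
  fixes g p :: "'a \<Rightarrow> real" and e q :: "'b \<Rightarrow> real"
  assumes g: "has_bochner_integral S (\<lambda>s. (g s)\<^sup>2) a" "has_bochner_integral S (\<lambda>s. g s * p s) b"
      "has_bochner_integral S (\<lambda>s. (p s)\<^sup>2) b"
    and e: "has_bochner_integral K (\<lambda>y. (e y)\<^sup>2) c" "has_bochner_integral K (\<lambda>y. e y * q y) d"
      "has_bochner_integral K (\<lambda>y. (q y)\<^sup>2) d"
  shows "(\<integral>\<^sup>+ s. (\<integral>\<^sup>+ y. ennreal ((g s * e y - p s * q y)\<^sup>2) \<partial>K) \<partial>S) = ennreal (a * c - b * d)"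
proof -
  let ?v = "\<lambda>s. (g s)\<^sup>2 * c - 2 * (g s * p s) * d + (p s)\<^sup>2 * d"
  have inner: "(\<integral>\<^sup>+ y. ennreal ((g s * e y - p s * q y)\<^sup>2) \<partial>K) = ennreal (?v s)"
    and v: "0 \<le> ?v s" for s
  proof -
    have eq: "(g s * e y - p s * q y)\<^sup>2 =
        (g s)\<^sup>2 * (e y)\<^sup>2 - 2 * (g s * p s) * (e y * q y) + (p s)\<^sup>2 * (q y)\<^sup>2" for y
      by (simp add: power2_eq_square algebra_simps)
    have "has_bochner_integral K (\<lambda>y. (g s * e y - p s * q y)\<^sup>2) (?v s)"
      unfolding eq
      by (intro has_bochner_integral_add has_bochner_integral_diff has_bochner_integral_mult_right e)
    then show "(\<integral>\<^sup>+ y. ennreal ((g s * e y - p s * q y)\<^sup>2) \<partial>K) = ennreal (?v s)" "0 \<le> ?v s"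
      using integral_nonneg_AE[of "\<lambda>y. (g s * e y - p s * q y)\<^sup>2" K]
      by (auto simp: has_bochner_integral_iff nn_integral_eq_integral)
  qed
  have "has_bochner_integral S ?v (a * c - 2 * b * d + b * d)"
    by (intro has_bochner_integral_add has_bochner_integral_diff has_bochner_integral_mult_right
        has_bochner_integral_mult_left g)
  then have "(\<integral>\<^sup>+ s. ennreal (?v s) \<partial>S) = ennreal (a * c - 2 * b * d + b * d)"
    using v by (simp add: has_bochner_integral_iff nn_integral_eq_integral)
  moreover have "a * c - 2 * b * d + b * d = a * c - b * d"
    by simp
  ultimately show ?thesis
    by (simp only: inner)
qed

section \<open>The factors of a mode and their projection errors\<close>

definition decay :: "real \<Rightarrow> real \<Rightarrow> real \<Rightarrow> real" where
  "decay \<mu> t s = indicator {0<..<t} s * exp (- (\<mu> * (t - s)))"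

text \<open>The continuous nondecreasing function that agrees with \<^const>\<open>decay\<close> on \<open>(0, t)\<close> and stays at
  its final value 1 afterwards; divided by \<open>\<mu>\<close> it is a primitive of \<^const>\<open>decay\<close> on \<open>(0, \<infinity>)\<close>.\<close>

definition ramp :: "real \<Rightarrow> real \<Rightarrow> real \<Rightarrow> real" where
  "ramp \<mu> t s = exp (- (\<mu> * max (t - s) 0))"

lemma decay_measurable [measurable]: "decay \<mu> t \<in> borel_measurable borel"
  unfolding decay_def[abs_def] by measurable

lemma decay_nonneg: "0 \<le> decay \<mu> t s"
  by (simp add: decay_def)

lemma decay_bounded: "0 \<le> \<mu> \<Longrightarrow> \<bar>decay \<mu> t s\<bar> \<le> 1"
  by (auto simp: decay_def indicator_def)

lemma decay_square: "(decay \<mu> t s)\<^sup>2 = decay (2 * \<mu>) t s"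
  by (auto simp: decay_def indicator_def power2_eq_square exp_add[symmetric] algebra_simps)

lemma ramp_bounds: "0 \<le> \<mu> \<Longrightarrow> 0 \<le> ramp \<mu> t s \<and> ramp \<mu> t s \<le> 1"
  by (auto simp: ramp_def)

lemma ramp_mono: "0 \<le> \<mu> \<Longrightarrow> s \<le> s' \<Longrightarrow> ramp \<mu> t s \<le> ramp \<mu> t s'"
  by (auto simp: ramp_def intro!: mult_left_mono)

lemma LINT_Ioo_FTC:
  fixes F f :: "real \<Rightarrow> real"
  assumes "a \<le> b" and F: "\<And>x. DERIV F x :> f x" and f: "\<And>x. isCont f x"
  shows "(LINT s:{a<..<b}|lborel. f s) = F b - F a"
proof -
  have ne: "AE s in lborel. s \<noteq> a" "AE s in lborel. s \<noteq> b"
    by (auto intro: AE_lborel_singleton)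
  have [measurable]: "f \<in> borel_measurable borel"
    using f by (intro borel_measurable_continuous_onI continuous_at_imp_continuous_on) auto
  have "(LINT s:{a<..<b}|lborel. f s) = (LINT s|lborel. f s * indicator {a..b} s)"
    unfolding set_lebesgue_integral_def
  proof (rule integral_cong_AE)
    show "AE s in lborel. indicator {a<..<b} s *\<^sub>R f s = f s * indicator {a..b} s"
      using ne by eventually_elim (auto simp: indicator_def)
  qed measurable
  also have "\<dots> = F b - F a"
    by (rule integral_FTC_Icc_real[OF assms(1)]) (use F f in auto)
  finally show ?thesis .
qed

lemma LINT_decay:
  assumes "0 < \<mu>" "0 \<le> a" "a \<le> b"
  shows "(LINT s:{a<..<b}|lborel. decay \<mu> t s) = (ramp \<mu> t b - ramp \<mu> t a) / \<mu>"
proof (cases "a < t")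
  case True
  let ?F = "\<lambda>s. exp (- (\<mu> * (t - s))) / \<mu>"
  have "(LINT s:{a<..<b}|lborel. decay \<mu> t s) = (LINT s:{a<..<min b t}|lborel. exp (- (\<mu> * (t - s))))"
    unfolding set_lebesgue_integral_def using assms
    by (intro Bochner_Integration.integral_cong) (auto simp: decay_def indicator_def)
  also have "\<dots> = ?F (min b t) - ?F a"
    using assms True by (intro LINT_Ioo_FTC) (auto intro!: derivative_eq_intros continuous_intros)
  also have "\<dots> = (ramp \<mu> t b - ramp \<mu> t a) / \<mu>"
    using assms True by (auto simp: ramp_def diff_divide_distrib min_def max_def)
  finally show ?thesis .
next
  case False
  then have "indicator {a<..<b} s *\<^sub>R decay \<mu> t s = 0" for s
    by (auto simp: decay_def indicator_def)
  then have "(LINT s:{a<..<b}|lborel. decay \<mu> t s) = 0"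
    unfolding set_lebesgue_integral_def by (simp only: integral_zero)
  also have "\<dots> = (ramp \<mu> t b - ramp \<mu> t a) / \<mu>"
    using assms False by (simp add: ramp_def max_def)
  finally show ?thesis .
qed

lemma LINT_decay_le:
  assumes "0 < \<mu>" "0 \<le> a" "a \<le> b"
  shows "(LINT s:{a<..<b}|lborel. decay \<mu> t s) \<le> 1 / \<mu>"
  unfolding LINT_decay[OF assms]
  using ramp_bounds[of \<mu> t a] ramp_bounds[of \<mu> t b] assms by (intro divide_right_mono) auto

lemma decay_norm:
  assumes "0 < \<mu>" "0 \<le> t" "t \<le> L" "0 < L"
  shows "(LINT s|ivl_measure L. (decay \<mu> t s)\<^sup>2) = (1 - exp (- (2 * \<mu> * t))) / (2 * \<mu>)"
proof -
  have "(LINT s|ivl_measure L. (decay \<mu> t s)\<^sup>2) = (LINT s:{0<..<L}|lborel. decay (2 * \<mu>) t s)"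
    unfolding set_lebesgue_integral_def decay_square by (subst integral_restrict_space) auto
  also have "\<dots> = (ramp (2 * \<mu>) t L - ramp (2 * \<mu>) t 0) / (2 * \<mu>)"
    using assms by (intro LINT_decay) auto
  also have "\<dots> = (1 - exp (- (2 * \<mu> * t))) / (2 * \<mu>)"
    using assms by (simp add: ramp_def max_def)
  finally show ?thesis .
qed

text \<open>On \<open>(0, \<infinity>)\<close> the function is the difference of two nondecreasing functions with values in
  \<open>[0, 1]\<close>, namely the ramp and the unit step at \<open>t\<close>. Its oscillations over the cells
  therefore add up to at most 2, and none of them exceeds 2, so their
  squares add up to at most 4. The bound does not depend on \<open>\<mu>\<close>.\<close>

lemma decay_proj_error_le:
  assumes \<mu>: "0 < \<mu>" and L: "0 < L" and m: "1 \<le> m"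
  shows "(LINT s|ivl_measure L. (decay \<mu> t s)\<^sup>2) - proj_energy L m (decay \<mu> t) \<le> 4 * (L / real m)"
proof -
  let ?d = "L / real m"
  (* The increment of v over a cell bounds the oscillation there. *)
  define v where "v = (\<lambda>s. ramp \<mu> t s + (if t \<le> s then 1 else 0))"
  define D where "D = (\<lambda>i. v (real i * ?d) - v (real (i - 1) * ?d))"
  have d: "0 < ?d"
    using L m by auto
  have v: "0 \<le> v s" "v s \<le> 2" "s \<le> s' \<Longrightarrow> v s \<le> v s'" for s s'
    using ramp_bounds[of \<mu> t s] ramp_mono[of \<mu> s s' t] \<mu> by (auto simp: v_def)
  have D0: "0 \<le> D i" for i
  proof -
    have "real (i - 1) * ?d \<le> real i * ?d"
      using d by (intro mult_right_mono) auto
    then show ?thesis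
      unfolding D_def using v(3) by (simp only: diff_ge_0_iff_ge)
  qed
  have D2: "D i \<le> 2" for i
    unfolding D_def using v(1)[of "real (i - 1) * ?d"] v(2)[of "real i * ?d"] by linarith
  have one_sided: "decay \<mu> t s - decay \<mu> t s' \<le> D i"
    if i: "i \<in> {1..m}" and s: "s \<in> grid_cell L m i" "s' \<in> grid_cell L m i" for i s s'
  proof -
    have in_cell: "real (i - 1) * ?d < x \<and> x < real i * ?d \<and> 0 < x" if "x \<in> grid_cell L m i" for x
      using grid_cell_subset[OF L i] that by (auto simp: grid_cell_def)
    have split: "decay \<mu> t x = ramp \<mu> t x - (if t \<le> x then 1 else 0)" if "0 < x" for x
      using that by (auto simp: decay_def ramp_def indicator_def max_def)
    have mono_step: "(if t \<le> x then 1 else 0 :: real) \<le> (if t \<le> y then 1 else 0)" if "x \<le> y" for x y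
      using that by auto
    show ?thesis
      using in_cell[OF s(1)] in_cell[OF s(2)] split[of s] split[of s']
        ramp_mono[of \<mu> s "real i * ?d" t] ramp_mono[of \<mu> "real (i - 1) * ?d" s' t]
        mono_step[of s' "real i * ?d"] mono_step[of "real (i - 1) * ?d" s] \<mu>
      unfolding D_def v_def by linarith
  qed
  have osc: "\<bar>decay \<mu> t s - decay \<mu> t s'\<bar> \<le> D i"
    if i: "i \<in> {1..m}" and s: "s \<in> grid_cell L m i" "s' \<in> grid_cell L m i" for i s s'
    using one_sided[OF i s] one_sided[OF i s(2,1)] by (simp add: abs_le_iff)
  have "(\<Sum>i=1..m. D i) = v (real m * ?d) - v 0"
  proof -
    have "(\<Sum>i=1..m. D i) = (\<Sum>k<m. D (Suc k))"
      by (rule sum.reindex_bij_witness[of _ Suc "\<lambda>i. i - 1"]) auto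
    also have "\<dots> = (\<Sum>k<m. v (real (Suc k) * ?d) - v (real k * ?d))"
      by (simp add: D_def)
    also have "\<dots> = v (real m * ?d) - v (real 0 * ?d)"
      by (rule sum_lessThan_telescope)
    finally show ?thesis
      by simp
  qed
  then have sumD: "(\<Sum>i=1..m. D i) \<le> 2"
    using v(1)[of 0] v(2)[of "real m * ?d"] by linarith
  have "(LINT s|ivl_measure L. (decay \<mu> t s)\<^sup>2) - proj_energy L m (decay \<mu> t) \<le> ?d * (\<Sum>i=1..m. (D i)\<^sup>2)"
    using \<mu> by (intro step_proj_error_le_oscillation[OF decay_measurable decay_bounded L m osc]) auto
  also have "\<dots> \<le> ?d * (\<Sum>i=1..m. 2 * D i)"
    using d D0 D2 by (intro mult_left_mono sum_mono) (auto simp: power2_eq_square intro!: mult_right_mono)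
  also have "\<dots> \<le> ?d * 4"
    using d sumD by (intro mult_left_mono) (auto simp: sum_distrib_left[symmetric])
  finally show ?thesis
    by (simp add: mult.commute)
qed

lemma eigfun_measurable [measurable]: "eigfun k \<in> borel_measurable borel"
  unfolding eigfun_def[abs_def] by measurable

lemma eigfun_bounded: "\<bar>eigfun k x\<bar> \<le> sqrt 2"
  unfolding eigfun_def abs_mult by (simp add: mult_left_le)

lemma eigfun_lipschitz: "\<bar>eigfun k x - eigfun k y\<bar> \<le> sqrt 2 * eigval k * \<bar>x - y\<bar>"
proof -
  have "\<bar>sin a - sin b\<bar> \<le> \<bar>a - b\<bar>" for a b :: real
  proof -
    have "\<bar>sin a - sin b\<bar> = 2 * \<bar>sin ((a - b) / 2)\<bar> * \<bar>cos ((a + b) / 2)\<bar>"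
      by (simp add: sin_diff_sin abs_mult)
    also have "\<dots> \<le> 2 * \<bar>(a - b) / 2\<bar> * 1"
      by (intro mult_mono mult_left_mono abs_sin_x_le_abs_x) auto
    finally show ?thesis
      by simp
  qed
  from this[of "eigval k * x" "eigval k * y"] show ?thesis
    by (simp add: eigfun_def right_diff_distrib[symmetric] abs_mult eigval_def mult.assoc)
qed

lemma eigfun_orthonormal:
  "has_bochner_integral (ivl_measure 1) (\<lambda>x. eigfun (Suc k) x * eigfun (Suc l) x) (if k = l then 1 else 0)"
proof -
  define c where "c = (\<lambda>n :: int. LINT x:{0<..<1}|lborel. cos (of_int n * pi * x))"
  have c: "c n = (if n = 0 then 1 else 0)" for n
  proof (cases "n = 0")
    case True
    then show ?thesis
      by (simp add: c_def set_lebesgue_integral_def)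
  next
    case False
    have "c n = sin (of_int n * pi * 1) / (of_int n * pi) - sin (of_int n * pi * 0) / (of_int n * pi)"
      unfolding c_def using False
      by (intro LINT_Ioo_FTC) (auto intro!: derivative_eq_intros continuous_intros)
    also have "\<dots> = 0"
      using sin_npi_int[of n] by (simp add: mult.commute)
    finally show ?thesis
      using False by simp
  qed
  let ?n = "int k - int l" and ?m = "int k + int l + 2"
  have prod: "eigfun (Suc k) x * eigfun (Suc l) x = cos (of_int ?n * pi * x) - cos (of_int ?m * pi * x)" for x
  proof -
    have "eigfun (Suc k) x * eigfun (Suc l) x = 2 * (sin (eigval (Suc k) * x) * sin (eigval (Suc l) * x))"
      by (simp add: eigfun_def)
    also have "\<dots> = cos (eigval (Suc k) * x - eigval (Suc l) * x) - cos (eigval (Suc k) * x + eigval (Suc l) * x)"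
      by (simp add: sin_times_sin)
    finally show ?thesis
      by (simp add: eigval_def algebra_simps)
  qed
  have int: "integrable (ivl_measure 1) (\<lambda>x. cos (of_int n * pi * x))" for n :: int
    by (rule integrable_ivl_bounded[of _ 1]) auto
  have val: "(LINT x|ivl_measure 1. cos (of_int n * pi * x)) = c n" for n :: int
    unfolding c_def set_lebesgue_integral_def by (subst integral_restrict_space) auto
  have "has_bochner_integral (ivl_measure 1) (\<lambda>x. cos (of_int ?n * pi * x) - cos (of_int ?m * pi * x)) (c ?n - c ?m)"
    using int val by (intro has_bochner_integral_diff) (simp_all only: has_bochner_integral_iff)
  moreover have "c ?n - c ?m = (if k = l then 1 else 0)"
    by (simp add: c)
  ultimately show ?thesis
    by (simp only: prod)
qed

lemma eigfun_norm: "(LINT x|ivl_measure 1. (eigfun (Suc k) x)\<^sup>2) = 1"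
  using eigfun_orthonormal[of k k] by (simp add: has_bochner_integral_iff power2_eq_square)

lemma eigfun_proj_error_le:
  assumes m: "1 \<le> m"
  shows "1 - proj_energy 1 m (eigfun (Suc k)) \<le> 2 * (eigval (Suc k))\<^sup>2 * (1 / real m)\<^sup>2"
proof -
  let ?D = "sqrt 2 * eigval (Suc k) * (1 / real m)"
  have osc: "\<bar>eigfun (Suc k) x - eigfun (Suc k) y\<bar> \<le> ?D"
    if i: "i \<in> {1..m}" and x: "x \<in> grid_cell 1 m i" "y \<in> grid_cell 1 m i" for i x y
  proof -
    obtain j where j: "i = Suc j"
      using i by (cases i) auto
    have "\<bar>x - y\<bar> \<le> 1 / real m"
      using x unfolding grid_cell_def j by (auto simp: abs_le_iff distrib_right add_divide_distrib)
    then have "sqrt 2 * eigval (Suc k) * \<bar>x - y\<bar> \<le> ?D"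
      by (intro mult_left_mono) (auto simp: eigval_def)
    then show ?thesis
      using eigfun_lipschitz[of "Suc k" x y] by linarith
  qed
  have "1 - proj_energy 1 m (eigfun (Suc k)) \<le> 1 / real m * (\<Sum>i=1..m. ?D\<^sup>2)"
    using step_proj_error_le_oscillation[OF eigfun_measurable eigfun_bounded zero_less_one m osc]
    unfolding eigfun_norm .
  also have "\<dots> = ?D\<^sup>2"
    using m by simp
  finally show ?thesis
    by (simp only: power_mult_distrib real_sqrt_pow2_iff) simp
qed

section \<open>The error in a single mode\<close>

text \<open>The mean square error in the mode with index \<open>k\<close>: the squared norm of
  \<^term>\<open>decay ((eigval k)\<^sup>2) t s * eigfun k y\<close> as a function of \<open>(s, y)\<close>, minus the squared
  norm of its projection.\<close>

definition mode_error :: "real \<Rightarrow> nat \<Rightarrow> nat \<Rightarrow> nat \<Rightarrow> real \<Rightarrow> real" where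
  "mode_error T N J k t =
     (1 - exp (- (2 * (eigval k)\<^sup>2 * t))) / (2 * (eigval k)\<^sup>2) -
     proj_energy T N (decay ((eigval k)\<^sup>2) t) * proj_energy 1 J (eigfun k)"

lemma eigval_Suc_pos: "0 < (eigval (Suc k))\<^sup>2"
  by (simp add: eigval_def)

lemma inverse_eigval_square_le: "1 / (2 * (eigval (Suc k))\<^sup>2) \<le> 1 / (real (Suc k))\<^sup>2"
proof -
  have "(real (Suc k))\<^sup>2 * 1 \<le> (real (Suc k))\<^sup>2 * (2 * pi\<^sup>2)"
  proof (intro mult_left_mono)
    have "1 \<le> pi\<^sup>2"
      using pi_gt3 by (simp add: power2_eq_square mult_mono[of 1 pi 1 pi, simplified])
    then show "1 \<le> 2 * pi\<^sup>2"
      by simp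
  qed simp
  then show ?thesis
    by (intro divide_left_mono) (auto simp: eigval_def power_mult_distrib mult_ac)
qed

lemma summable_inverse_eigval_square: "summable (\<lambda>k. 1 / (eigval (Suc k))\<^sup>2)"
proof -
  have "summable (\<lambda>k. 1 / (real (Suc k))\<^sup>2)"
    using inverse_power_summable[of 2, where 'a = real] by (simp add: summable_Suc_iff[of "\<lambda>n. 1 / (real n)\<^sup>2"] inverse_eq_divide del: of_nat_Suc)
  then have "summable (\<lambda>k. (1 / pi\<^sup>2) * (1 / (real (Suc k))\<^sup>2))"
    by (rule summable_mult)
  then show ?thesis
    by (simp add: eigval_def power_mult_distrib mult.commute del: of_nat_Suc)
qed

text \<open>With squared norms \<open>a\<close> and 1 of the two factors and \<open>b\<close> and \<open>d\<close> of their
  projections, the error is \<open>a - b d = (a - b) + b (1 - d)\<close>: a temporal part and a spatial part.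
  Each is bounded by its one-dimensional projection error and, for high modes, by the squared
  norm of the mode itself, which is smaller than \<open>1 / k\<^sup>2\<close>.\<close>

lemma mode_error_bounds:
  assumes T: "0 < T" and t: "0 \<le> t" "t \<le> T"
  shows "0 \<le> mode_error T N J (Suc k) t" "mode_error T N J (Suc k) t \<le> 1 / (2 * (eigval (Suc k))\<^sup>2)"
    and "1 \<le> N \<Longrightarrow> 1 \<le> J \<Longrightarrow> mode_error T N J (Suc k) t \<le>
      min ((2 * sqrt (T / real N))\<^sup>2) (1 / (real (Suc k))\<^sup>2) + min ((1 / real J)\<^sup>2) (1 / (real (Suc k))\<^sup>2)"
proof -
  let ?\<mu> = "(eigval (Suc k))\<^sup>2"
  have \<mu>: "0 < ?\<mu>"
    by (rule eigval_Suc_pos)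
  define a where "a = (1 - exp (- (2 * ?\<mu> * t))) / (2 * ?\<mu>)"
  define b where "b = proj_energy T N (decay ?\<mu> t)"
  define d where "d = proj_energy 1 J (eigfun (Suc k))"
  have e: "mode_error T N J (Suc k) t = a - b * d"
    by (simp add: mode_error_def a_def b_def d_def)
  have a: "a = (LINT s|ivl_measure T. (decay ?\<mu> t s)\<^sup>2)"
    using decay_norm[OF \<mu> t T] by (simp add: a_def)
  have ba: "b \<le> a"
    unfolding a b_def using \<mu> by (intro proj_energy_le[OF decay_measurable decay_bounded T]) simp
  have b0: "0 \<le> b"
    unfolding b_def by (rule proj_energy_nonneg[OF T])
  have d0: "0 \<le> d"
    unfolding d_def by (rule proj_energy_nonneg) simp
  have d1: "d \<le> 1"
    using proj_energy_le[OF eigfun_measurable eigfun_bounded, of 1 J "Suc k"] unfolding d_def eigfun_norm by simp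
  have au: "a \<le> 1 / (2 * ?\<mu>)"
    unfolding a_def using \<mu> by (intro divide_right_mono) auto
  have bd: "b * d \<le> a"
    using mult_mono[OF ba d1] b0 d0 ba by simp
  have bd0: "0 \<le> b * d"
    using b0 d0 by simp
  show "0 \<le> mode_error T N J (Suc k) t" "mode_error T N J (Suc k) t \<le> 1 / (2 * ?\<mu>)"
    using bd bd0 au unfolding e by auto
  assume N: "1 \<le> N" and J: "1 \<le> J"
  have sq: "(2 * sqrt (T / real N))\<^sup>2 = 4 * (T / real N)"
    using T by (simp add: power_mult_distrib)
  have "a - b \<le> 4 * (T / real N)"
    unfolding a b_def by (rule decay_proj_error_le[OF \<mu> T N])
  moreover have "a - b \<le> 1 / (real (Suc k))\<^sup>2"
    using au b0 inverse_eigval_square_le[of k] by linarith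
  ultimately have 1: "a - b \<le> min ((2 * sqrt (T / real N))\<^sup>2) (1 / (real (Suc k))\<^sup>2)"
    unfolding sq by simp
  have "b * (1 - d) \<le> 1 / (2 * ?\<mu>) * (2 * ?\<mu> * (1 / real J)\<^sup>2)"
    using ba au b0 d1 eigfun_proj_error_le[OF J, of k] \<mu> unfolding d_def[symmetric]
    by (intro mult_mono) auto
  also have "\<dots> = (1 / real J)\<^sup>2"
    using \<mu> by simp
  finally have 2: "b * (1 - d) \<le> (1 / real J)\<^sup>2" .
  have "b * (1 - d) \<le> 1 / (2 * ?\<mu>) * 1"
    using ba au b0 d0 d1 \<mu> by (intro mult_mono) auto
  then have 3: "b * (1 - d) \<le> 1 / (real (Suc k))\<^sup>2"
    using inverse_eigval_square_le[of k] by linarith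
  have "a - b * d = (a - b) + b * (1 - d)"
    by (simp add: algebra_simps)
  also have "\<dots> \<le> min ((2 * sqrt (T / real N))\<^sup>2) (1 / (real (Suc k))\<^sup>2) + min ((1 / real J)\<^sup>2) (1 / (real (Suc k))\<^sup>2)"
    using 1 2 3 by (intro add_mono) auto
  finally show "mode_error T N J (Suc k) t \<le>
      min ((2 * sqrt (T / real N))\<^sup>2) (1 / (real (Suc k))\<^sup>2) + min ((1 / real J)\<^sup>2) (1 / (real (Suc k))\<^sup>2)"
    unfolding e .
qed

text \<open>By the explicit primitive the cell averages are continuous functions of the final time.\<close>

lemma continuous_on_proj_energy_decay:
  assumes "0 < T" and \<mu>: "0 < \<mu>"
  shows "continuous_on S (\<lambda>t. proj_energy T N (decay \<mu> t))"
proof -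
  have le: "real (i - 1) * (T / real N) \<le> real i * (T / real N)" for i
    using assms by (intro mult_right_mono) auto
  have "0 \<le> real (i - 1) * (T / real N)" for i
    using assms by simp
  then have avg: "cell_avg T N (decay \<mu> t) i =
      (ramp \<mu> t (real i * (T / real N)) - ramp \<mu> t (real (i - 1) * (T / real N))) / \<mu> / (T / real N)" for t i
    unfolding cell_avg_def grid_cell_def by (simp only: LINT_decay[OF \<mu> _ le])
  have "continuous_on S (\<lambda>t. ramp \<mu> t s)" for s
    unfolding ramp_def by (intro continuous_intros)
  then have "continuous_on S (\<lambda>t. (ramp \<mu> t a - ramp \<mu> t b) * c * c')" for a b c c'
    by (intro continuous_intros)
  then show ?thesis
    unfolding proj_energy_def avg divide_inverse
    by (intro continuous_on_mult_left continuous_on_sum continuous_on_power)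
qed

lemma continuous_on_mode_error:
  assumes "0 < T"
  shows "continuous_on S (mode_error T N J (Suc k))"
  unfolding mode_error_def[abs_def] using eigval_Suc_pos[of k]
  by (intro continuous_on_diff continuous_on_mult_right continuous_on_proj_energy_decay assms
      continuous_on_divide continuous_on_const continuous_on_exp continuous_on_minus
      continuous_on_mult_left continuous_on_id) auto

text \<open>The term with index \<open>k\<close> is at most \<open>2 r\<close> times the increment of \<open>arctan\<close> over
  \<open>[r (k - 1), r k]\<close>, and these increments telescope.\<close>

lemma suminf_min_inverse_square_le:
  assumes r: "0 < r"
  shows "summable (\<lambda>k. min (r\<^sup>2) (1 / (real (Suc k))\<^sup>2))"
    and "(\<Sum>k. min (r\<^sup>2) (1 / (real (Suc k))\<^sup>2)) \<le> pi * r"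
proof -
  let ?a = "\<lambda>k. min (r\<^sup>2) (1 / (real (Suc k))\<^sup>2)"
  have term_le: "?a k \<le> 2 * r * (arctan (r * real (Suc k)) - arctan (r * real k))" for k
  proof -
    have "r * real k < r * real (Suc k)"
      using r by simp
    then obtain z where z: "r * real k < z" "z < r * real (Suc k)"
      and eq: "arctan (r * real (Suc k)) - arctan (r * real k) = (r * real (Suc k) - r * real k) * inverse (1 + z\<^sup>2)"
      using MVT2[of "r * real k" "r * real (Suc k)" arctan "\<lambda>x. inverse (1 + x\<^sup>2)"] DERIV_arctan by blast
    have z0: "0 \<le> z"
      using z(1) r by (smt (verit) mult_nonneg_nonneg of_nat_0_le_iff)
    have "z\<^sup>2 \<le> (r * real (Suc k))\<^sup>2"
      using z z0 by (intro power_mono) auto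
    then have "inverse (1 + (r * real (Suc k))\<^sup>2) \<le> inverse (1 + z\<^sup>2)"
      by (intro le_imp_inverse_le) (auto simp: add_pos_nonneg)
    then have "2 * r * (r * inverse (1 + (r * real (Suc k))\<^sup>2)) \<le> 2 * r * (r * inverse (1 + z\<^sup>2))"
      using r by (intro mult_left_mono) auto
    also have "r * inverse (1 + z\<^sup>2) = arctan (r * real (Suc k)) - arctan (r * real k)"
      unfolding eq by (simp add: algebra_simps)
    finally have le: "2 * r * (r * inverse (1 + (r * real (Suc k))\<^sup>2)) \<le>
        2 * r * (arctan (r * real (Suc k)) - arctan (r * real k))" .
    define q where "q = (r * real (Suc k))\<^sup>2"
    have q: "0 < q" and rq: "1 / (real (Suc k))\<^sup>2 = r\<^sup>2 / q"
      using r by (auto simp: q_def power_mult_distrib)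
    (* q is 1 at the index where the two arguments of min coincide. *)
    have "?a k \<le> 2 * r\<^sup>2 / (1 + q)"
    proof (cases "q \<le> 1")
      case True
      have "r\<^sup>2 \<le> 2 * r\<^sup>2 / (1 + q)"
        using True q mult_left_mono[of "1 + q" 2 "r\<^sup>2"] by (simp add: pos_le_divide_eq mult.commute)
      then show ?thesis
        by simp
    next
      case False
      have "r\<^sup>2 / q \<le> 2 * r\<^sup>2 / (1 + q)"
        using False q mult_left_mono[of "1 + q" "2 * q" "r\<^sup>2"] by (simp add: divide_simps algebra_simps)
      then show ?thesis
        unfolding rq by simp
    qed
    also have "\<dots> = 2 * r * (r * inverse (1 + (r * real (Suc k))\<^sup>2))"
      by (simp add: q_def divide_inverse power2_eq_square)
    finally show ?thesis
      using le by linarith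
  qed
  have partial: "(\<Sum>k<n. ?a k) \<le> pi * r" for n
  proof -
    have "(\<Sum>k<n. ?a k) \<le> (\<Sum>k<n. 2 * r * (arctan (r * real (Suc k)) - arctan (r * real k)))"
      by (intro sum_mono term_le)
    also have "\<dots> = 2 * r * (arctan (r * real n) - arctan (r * real 0))"
      by (subst sum_distrib_left[symmetric], subst sum_lessThan_telescope) simp
    also have "\<dots> \<le> 2 * r * (pi / 2)"
      using r arctan_ubound[of "r * real n"] by (intro mult_left_mono) auto
    finally show ?thesis
      by (simp add: mult.commute)
  qed
  have nonneg: "0 \<le> ?a k" for k
    by simp
  show sm: "summable ?a"
    using nonneg partial by (intro summableI_nonneg_bounded)
  show "suminf ?a \<le> pi * r"
    by (rule suminf_le_const[OF sm partial])
qed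

section \<open>Termwise integration of sine series\<close>

lemma set_LINT_eq_restrict_space:
  fixes g :: "real \<Rightarrow> real"
  assumes "S \<in> sets borel"
  shows "(LINT s:S|lborel. g s) = (LINT s|restrict_space lborel S. g s)"
  unfolding set_lebesgue_integral_def using assms by (subst integral_restrict_space) auto

lemma sums_LINT_ivl_bounded:
  fixes f :: "nat \<Rightarrow> real \<Rightarrow> real"
  assumes f: "\<And>k. f k \<in> borel_measurable borel" "\<And>k x. \<bar>f k x\<bar> \<le> B k" and B: "summable B"
  shows "(\<lambda>k. LINT x|restrict_space lborel {a<..<b}. f k x) sums (LINT x|restrict_space lborel {a<..<b}. (\<Sum>k. f k x))"
proof (rule sums_integral)
  let ?U = "restrict_space lborel {a<..<b}"
  interpret finite_measure ?U
    by (rule finite_measure_ivl)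
  show "integrable ?U (f k)" for k
    by (rule integrable_ivl_bounded[OF f])
  have "summable (\<lambda>k. norm (f k x))" for x
    using f(2) by (intro summable_comparison_test'[OF B]) simp
  then show "AE x in ?U. summable (\<lambda>k. norm (f k x))"
    by simp
  show "summable (\<lambda>k. LINT x|?U. norm (f k x))"
  proof (rule summable_comparison_test')
    show "summable (\<lambda>k. measure ?U (space ?U) * B k)"
      using B by (rule summable_mult)
    fix k :: nat
    have "(LINT x|?U. norm (f k x)) \<le> (LINT x|?U. B k)"
      using integrable_ivl_bounded[OF f, of a b k] f(2)[of k] by (intro integral_mono) auto
    then show "norm (LINT x|?U. norm (f k x)) \<le> measure ?U (space ?U) * B k"
      by simp
  qed
qed

text \<open>Absolute summability makes the sine series converge uniformly, so it may be integrated term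
  by term, once against each basis function, which by orthonormality returns the coefficients, and
  then against itself.\<close>

lemma nn_integral_sine_series_square:
  assumes b: "summable (\<lambda>k. \<bar>b k\<bar>)"
  shows "(\<integral>\<^sup>+ x. ennreal ((\<Sum>k. eigfun (Suc k) x * b k)\<^sup>2) \<partial>ivl_measure 1) = (\<Sum>k. ennreal ((b k)\<^sup>2))"
proof -
  define g where "g = (\<lambda>x. \<Sum>k. eigfun (Suc k) x * b k)"
  define G where "G = (\<Sum>k. sqrt 2 * \<bar>b k\<bar>)"
  have term_bound: "\<bar>eigfun (Suc k) x * b k\<bar> \<le> sqrt 2 * \<bar>b k\<bar>" for k x
    unfolding abs_mult by (intro mult_right_mono eigfun_bounded) auto
  have sb: "summable (\<lambda>k. sqrt 2 * \<bar>b k\<bar>)"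
    using b by (rule summable_mult)
  have sabs: "summable (\<lambda>k. \<bar>eigfun (Suc k) x * b k\<bar>)" for x
    using term_bound by (intro summable_comparison_test'[OF sb]) simp
  have gm [measurable]: "g \<in> borel_measurable borel"
    unfolding g_def by measurable
  have gb: "\<bar>g x\<bar> \<le> G" for x
  proof -
    have "\<bar>g x\<bar> \<le> (\<Sum>k. \<bar>eigfun (Suc k) x * b k\<bar>)"
      unfolding g_def by (rule summable_rabs[OF sabs])
    also have "\<dots> \<le> G"
      unfolding G_def by (rule suminf_le[OF term_bound sabs sb])
    finally show ?thesis .
  qed
  have expand: "g x * h = (\<Sum>k. eigfun (Suc k) x * b k * h)" for x h
    unfolding g_def by (rule suminf_mult2[OF summable_rabs_cancel[OF sabs]])
  have coeff: "(LINT x|ivl_measure 1. g x * eigfun (Suc l) x) = b l" for l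
  proof -
    have "(\<lambda>k. LINT x|ivl_measure 1. eigfun (Suc k) x * b k * eigfun (Suc l) x) sums
        (LINT x|ivl_measure 1. (\<Sum>k. eigfun (Suc k) x * b k * eigfun (Suc l) x))"
    proof (rule sums_LINT_ivl_bounded)
      show "\<bar>eigfun (Suc k) x * b k * eigfun (Suc l) x\<bar> \<le> sqrt 2 * \<bar>b k\<bar> * sqrt 2" for k x
        unfolding abs_mult[of _ "eigfun (Suc l) x"]
        by (intro mult_mono term_bound eigfun_bounded) auto
      show "summable (\<lambda>k. sqrt 2 * \<bar>b k\<bar> * sqrt 2)"
        using sb by (rule summable_mult2)
    qed measurable
    moreover have "(LINT x|ivl_measure 1. eigfun (Suc k) x * b k * eigfun (Suc l) x) = (if k = l then b k else 0)" for k
    proof -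
      have "(LINT x|ivl_measure 1. eigfun (Suc k) x * b k * eigfun (Suc l) x) =
          (LINT x|ivl_measure 1. b k * (eigfun (Suc k) x * eigfun (Suc l) x))"
        by (simp only: ac_simps)
      also have "\<dots> = b k * (if k = l then 1 else 0)"
        using has_bochner_integral_integral_eq[OF has_bochner_integral_mult_right[OF eigfun_orthonormal[of k l], of "b k"]]
        by simp
      finally show ?thesis
        by simp
    qed
    ultimately have "(\<lambda>k. if k = l then b k else 0) sums (LINT x|ivl_measure 1. g x * eigfun (Suc l) x)"
      by (simp only: expand)
    then show ?thesis
      using sums_unique2[OF sums_single[of l b]] by simp
  qed
  have "(\<lambda>k. LINT x|ivl_measure 1. eigfun (Suc k) x * b k * g x) sums
      (LINT x|ivl_measure 1. (\<Sum>k. eigfun (Suc k) x * b k * g x))"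
  proof (rule sums_LINT_ivl_bounded)
    show "\<bar>eigfun (Suc k) x * b k * g x\<bar> \<le> sqrt 2 * \<bar>b k\<bar> * G" for k x
      unfolding abs_mult[of _ "g x"] by (intro mult_mono term_bound gb) auto
    show "summable (\<lambda>k. sqrt 2 * \<bar>b k\<bar> * G)"
      using sb by (rule summable_mult2)
  qed measurable
  moreover have "(LINT x|ivl_measure 1. eigfun (Suc k) x * b k * g x) = (b k)\<^sup>2" for k
  proof -
    have "(LINT x|ivl_measure 1. eigfun (Suc k) x * b k * g x) = (LINT x|ivl_measure 1. b k * (g x * eigfun (Suc k) x))"
      by (simp only: ac_simps)
    then show ?thesis
      by (simp add: coeff power2_eq_square)
  qed
  ultimately have sums: "(\<lambda>k. (b k)\<^sup>2) sums (LINT x|ivl_measure 1. (g x)\<^sup>2)"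
    by (simp only: expand[symmetric] power2_eq_square)
  have "(\<integral>\<^sup>+ x. ennreal ((g x)\<^sup>2) \<partial>ivl_measure 1) = ennreal (LINT x|ivl_measure 1. (g x)\<^sup>2)"
    using integrable_ivl_bounded_mult[OF gm gb gm gb, of 0 1]
    by (intro nn_integral_eq_integral) (auto simp: power2_eq_square)
  also have "\<dots> = ennreal (\<Sum>k. (b k)\<^sup>2)"
    using sums by (simp add: sums_iff)
  also have "\<dots> = (\<Sum>k. ennreal ((b k)\<^sup>2))"
    using sums by (intro suminf_ennreal2[symmetric]) (auto simp: sums_iff)
  finally show ?thesis
    by (simp only: g_def)
qed

section \<open>The regularized solution as a combination of noise values\<close>

lemma cell_avg_bounded:
  assumes g: "g \<in> borel_measurable borel" "\<And>s. \<bar>g s\<bar> \<le> B" and L: "0 < L" and i: "i \<in> {1..m}"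
  shows "\<bar>cell_avg L m g i\<bar> \<le> B"
proof -
  let ?U = "restrict_space lborel (grid_cell L m i)"
  have d: "0 < L / real m"
    using L i by auto
  have int: "integrable ?U g"
    unfolding grid_cell_def by (rule integrable_ivl_bounded[OF g])
  have intc: "integrable ?U (\<lambda>_. B)"
    unfolding grid_cell_def by (rule integrable_ivl_bounded[of _ "\<bar>B\<bar>"]) auto
  have "\<bar>LINT s|?U. g s\<bar> \<le> (LINT s|?U. \<bar>g s\<bar>)"
    by (rule integral_abs_bound)
  also have "\<dots> \<le> (LINT s|?U. B)"
    using g by (intro integral_mono integrable_abs int intc)
  also have "\<dots> = B * (L / real m)"
    using measure_grid_cell[OF L i] by (simp add: measure_restrict_space space_restrict_space)
  finally have "\<bar>LINT s:grid_cell L m i|lborel. g s\<bar> \<le> B * (L / real m)"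
    by (simp only: set_LINT_eq_restrict_space[OF grid_cell_measurable])
  then show ?thesis
    by (simp only: cell_avg_def abs_divide[of _ "L / real m"] abs_of_pos[OF d] pos_divide_le_eq[OF d])
qed

lemma cell_avg_decay_bounds:
  assumes "0 < \<mu>" "0 < T"
  shows "0 \<le> cell_avg T N (decay \<mu> t) n" "cell_avg T N (decay \<mu> t) n \<le> 1 / \<mu> / (T / real N)"
proof -
  have le: "real (n - 1) * (T / real N) \<le> real n * (T / real N)" and nn: "0 \<le> real (n - 1) * (T / real N)"
    using assms by (auto intro!: mult_right_mono simp del: times_divide_eq_right)
  show "cell_avg T N (decay \<mu> t) n \<le> 1 / \<mu> / (T / real N)"
    unfolding cell_avg_def grid_cell_def using assms
    by (intro divide_right_mono LINT_decay_le le nn) auto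
  have "0 \<le> (LINT s:grid_cell T N n|lborel. decay \<mu> t s)"
    unfolding set_lebesgue_integral_def by (intro integral_nonneg_AE) (auto simp: decay_nonneg)
  then show "0 \<le> cell_avg T N (decay \<mu> t) n"
    unfolding cell_avg_def using assms by (intro divide_nonneg_nonneg) auto
qed

text \<open>Since \<^term>\<open>exp (- z) \<le> 1 / z\<close> for positive \<open>z\<close>, the heat kernel series converges
  absolutely at every positive time.\<close>

lemma summable_decay: "summable (\<lambda>k. decay ((eigval (Suc k))\<^sup>2) t s)"
proof (cases "0 < s \<and> s < t")
  case True
  have le: "decay ((eigval (Suc k))\<^sup>2) t s \<le> 1 / (t - s) * (1 / (eigval (Suc k))\<^sup>2)" for k
  proof -
    define z where "z = (eigval (Suc k))\<^sup>2 * (t - s)"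
    have z: "0 < z"
      using True eigval_Suc_pos[of k] by (simp add: z_def)
    have "z \<le> exp z"
      using exp_ge_add_one_self[of z] by linarith
    then have "exp (- z) \<le> 1 / z"
      using z by (simp add: exp_minus inverse_eq_divide divide_le_eq le_divide_eq frac_le)
    then show ?thesis
      using True by (simp add: decay_def z_def mult.commute)
  qed
  have "summable (\<lambda>k. 1 / (t - s) * (1 / (eigval (Suc k))\<^sup>2))"
    by (rule summable_mult[OF summable_inverse_eigval_square])
  then show ?thesis
    by (rule summable_comparison_test') (use le in \<open>simp add: decay_nonneg\<close>)
next
  case False
  then have "(\<lambda>k. decay ((eigval (Suc k))\<^sup>2) t s) = (\<lambda>k. 0)"
    by (auto simp: decay_def indicator_def)
  then show ?thesis
    by simp
qed

lemma summable_decay_mult: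
  assumes "\<And>k. \<bar>a k\<bar> \<le> B"
  shows "summable (\<lambda>k. \<bar>decay ((eigval (Suc k))\<^sup>2) t s * a k\<bar>)"
proof (rule summable_comparison_test')
  show "summable (\<lambda>k. decay ((eigval (Suc k))\<^sup>2) t s * B)"
    by (rule summable_mult2[OF summable_decay])
  show "norm \<bar>decay ((eigval (Suc k))\<^sup>2) t s * a k\<bar> \<le> decay ((eigval (Suc k))\<^sup>2) t s * B" for k
    using assms by (simp add: abs_mult decay_nonneg mult_left_mono)
qed

lemma heat_kernel_eq_decay_series:
  "indicator {0<..<t} s * heat_kernel (t - s) x y =
    (\<Sum>k. decay ((eigval (Suc k))\<^sup>2) t s * (eigfun (Suc k) x * eigfun (Suc k) y))"
  by (cases "s \<in> {0<..<t}") (simp_all add: heat_kernel_def decay_def mult.assoc)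

lemma heat_kernel_measurable [measurable]:
  assumes [measurable]: "\<tau> \<in> borel_measurable M" "\<xi> \<in> borel_measurable M" "\<eta> \<in> borel_measurable M"
  shows "(\<lambda>z. heat_kernel (\<tau> z) (\<xi> z) (\<eta> z)) \<in> borel_measurable M"
  unfolding heat_kernel_def by measurable

text \<open>The cell average over \<open>T\<^sub>n \<times> D\<^sub>j\<close> of the integrand of the mild solution at \<open>(t, x)\<close>.\<close>

definition kernel_avg :: "real \<Rightarrow> nat \<Rightarrow> nat \<Rightarrow> real \<Rightarrow> real \<Rightarrow> nat \<Rightarrow> nat \<Rightarrow> real" where
  "kernel_avg T N J t x n j =
     (\<Sum>k. eigfun (Suc k) x * (cell_avg T N (decay ((eigval (Suc k))\<^sup>2) t) n * cell_avg 1 J (eigfun (Suc k)) j))"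

lemma kernel_avg_measurable [measurable]: "(\<lambda>x. kernel_avg T N J t x n j) \<in> borel_measurable borel"
  unfolding kernel_avg_def by measurable

lemma summable_cell_avg_products:
  assumes T: "0 < T" and nj: "n \<in> {1..N}" "j \<in> {1..J}" and c: "\<And>k. \<bar>c k\<bar> \<le> B"
  shows "summable (\<lambda>k. \<bar>c k * (cell_avg T N (decay ((eigval (Suc k))\<^sup>2) t) n * cell_avg 1 J (eigfun (Suc k)) j)\<bar>)"
proof (rule summable_comparison_test')
  let ?K = "B * sqrt 2 / (T / real N)"
  show "summable (\<lambda>k. ?K * (1 / (eigval (Suc k))\<^sup>2))"
    by (rule summable_mult[OF summable_inverse_eigval_square])
  fix k :: nat
  let ?\<mu> = "(eigval (Suc k))\<^sup>2"
  have B: "0 \<le> B"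
    using c[of 0] by (rule order_trans[OF abs_ge_zero])
  have "\<bar>cell_avg T N (decay ?\<mu> t) n\<bar> \<le> 1 / ?\<mu> / (T / real N)"
    using cell_avg_decay_bounds[OF eigval_Suc_pos T] by (simp only: abs_of_nonneg)
  then have "\<bar>c k\<bar> * (\<bar>cell_avg T N (decay ?\<mu> t) n\<bar> * \<bar>cell_avg 1 J (eigfun (Suc k)) j\<bar>) \<le>
      B * ((1 / ?\<mu> / (T / real N)) * sqrt 2)"
    using B cell_avg_bounded[OF eigfun_measurable eigfun_bounded zero_less_one nj(2)]
    by (intro mult_mono c mult_nonneg_nonneg) (auto intro: order_trans[OF abs_ge_zero])
  then show "norm \<bar>c k * (cell_avg T N (decay ?\<mu> t) n * cell_avg 1 J (eigfun (Suc k)) j)\<bar> \<le> ?K * (1 / ?\<mu>)"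
    by (simp add: abs_mult ac_simps)
qed

lemma cell_eq_Times: "cell T N J n j = grid_cell T N n \<times> grid_cell 1 J j"
  by (simp add: cell_def grid_cell_def)

text \<open>At every time \<open>s < t\<close> the kernel is a uniformly convergent sine series in \<open>y\<close>, and
  its coefficients have time integrals that decay like \<open>1 / k\<^sup>2\<close>; so both integrations may be
  carried out term by term.\<close>

lemma regularized_solution_eq:
  assumes T: "0 < T" and t: "t \<in> {0..T}" and N: "1 \<le> N" and J: "1 \<le> J"
  shows "regularized_solution T N J W t x \<omega> =
    (\<Sum>n=1..N. \<Sum>j=1..J. kernel_avg T N J t x n j * W (cell T N J n j) \<omega>)"
proof -
  let ?\<mu> = "\<lambda>k. (eigval (Suc k))\<^sup>2"
  let ?e = "\<lambda>k. eigfun (Suc k)"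
  define dt where "dt = T / real N"
  define dx where "dx = 1 / real J"
  have pos: "0 < dt" "0 < dx"
    using T N J by (auto simp: dt_def dx_def)
  define w where "w = (\<lambda>n j. 1 / (dt * dx) * W (cell T N J n j) \<omega>)"
  have load: "discrete_load T N J W s y \<omega> =
      (\<Sum>n=1..N. \<Sum>j=1..J. w n j * indicator (grid_cell T N n) s * indicator (grid_cell 1 J j) y)" for s y
    unfolding discrete_load_def cell_eq_Times indicator_times w_def dt_def dx_def
    by (simp only: sum_distrib_left fst_conv snd_conv ac_simps)
  define a where "a = (\<lambda>k j. ?e k x * (dx * cell_avg 1 J (?e k) j))"
  have a_bound: "\<bar>a k j\<bar> \<le> sqrt 2 * (dx * sqrt 2)" if "j \<in> {1..J}" for k j
    unfolding a_def abs_mult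
    using cell_avg_bounded[OF eigfun_measurable[of "Suc k"] eigfun_bounded zero_less_one that] pos
    by (intro mult_mono eigfun_bounded) auto
  have inner: "indicator {0<..<t} s *\<^sub>R (LINT y:{0<..<1}|lborel. heat_kernel (t - s) x y * discrete_load T N J W s y \<omega>) =
      (\<Sum>n=1..N. \<Sum>j=1..J. w n j * (indicator (grid_cell T N n) s * (\<Sum>k. decay (?\<mu> k) t s * a k j)))" for s
  proof (cases "s \<in> {0<..<t}")
    case True
    define H where "H = (\<lambda>y. heat_kernel (t - s) x y)"
    have H_series: "H y = (\<Sum>k. decay (?\<mu> k) t s * (?e k x * ?e k y))" for y
      using heat_kernel_eq_decay_series[of t s x y] True by (simp add: H_def)
    have ee: "\<bar>?e k x * ?e k y\<bar> \<le> 2" for k y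
      using mult_mono[OF eigfun_bounded[of "Suc k" x] eigfun_bounded[of "Suc k" y]] by (simp add: abs_mult)
    have term_bound: "\<bar>decay (?\<mu> k) t s * (?e k x * ?e k y)\<bar> \<le> decay (?\<mu> k) t s * 2" for k y
      using ee by (simp add: abs_mult[of "decay _ _ _"] decay_nonneg mult_left_mono)
    have sd: "summable (\<lambda>k. decay (?\<mu> k) t s * 2)"
      by (rule summable_mult2[OF summable_decay])
    have Hm [measurable]: "H \<in> borel_measurable borel"
      unfolding H_def by measurable
    have Hb: "\<bar>H y\<bar> \<le> (\<Sum>k. decay (?\<mu> k) t s * 2)" for y
      unfolding H_series
      by (rule order_trans[OF summable_rabs[OF summable_decay_mult[OF ee]] suminf_le[OF term_bound summable_decay_mult[OF ee] sd]])
    have cellint: "has_bochner_integral (ivl_measure 1) (\<lambda>y. H y * indicator (grid_cell 1 J j) y)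
        (\<Sum>k. decay (?\<mu> k) t s * a k j)" if j: "j \<in> {1..J}" for j
    proof -
      have "(\<lambda>k. LINT y|ivl_measure 1. decay (?\<mu> k) t s * (?e k x * ?e k y) * indicator (grid_cell 1 J j) y) sums
          (LINT y|ivl_measure 1. (\<Sum>k. decay (?\<mu> k) t s * (?e k x * ?e k y) * indicator (grid_cell 1 J j) y))"
      proof (rule sums_LINT_ivl_bounded[OF _ _ sd])
        show "\<bar>decay (?\<mu> k) t s * (?e k x * ?e k y) * indicator (grid_cell 1 J j) y\<bar> \<le> decay (?\<mu> k) t s * 2" for k y
          using term_bound[of k y] by (auto simp: indicator_def decay_nonneg)
      qed measurable
      moreover have "(LINT y|ivl_measure 1. decay (?\<mu> k) t s * (?e k x * ?e k y) * indicator (grid_cell 1 J j) y) =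
          decay (?\<mu> k) t s * a k j" for k
      proof -
        have "(LINT y|ivl_measure 1. decay (?\<mu> k) t s * (?e k x * ?e k y) * indicator (grid_cell 1 J j) y) =
            (LINT y|ivl_measure 1. (decay (?\<mu> k) t s * ?e k x) * (?e k y * indicator (grid_cell 1 J j) y))"
          by (simp only: ac_simps)
        also have "\<dots> = (decay (?\<mu> k) t s * ?e k x) * (LINT y|ivl_measure 1. ?e k y * indicator (grid_cell 1 J j) y)"
          by (rule integral_mult_right_zero)
        finally show ?thesis
          by (simp only: LINT_ivl_indicator_cell[OF zero_less_one j] a_def dx_def ac_simps)
      qed
      moreover have "(\<Sum>k. decay (?\<mu> k) t s * (?e k x * ?e k y) * indicator (grid_cell 1 J j) y) =
          H y * indicator (grid_cell 1 J j) y" for y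
        unfolding H_series by (rule suminf_mult2[symmetric, OF summable_rabs_cancel[OF summable_decay_mult[OF ee]]])
      ultimately have "(LINT y|ivl_measure 1. H y * indicator (grid_cell 1 J j) y) = (\<Sum>k. decay (?\<mu> k) t s * a k j)"
        by (simp add: sums_iff)
      moreover have "integrable (ivl_measure 1) (\<lambda>y. H y * indicator (grid_cell 1 J j) y)"
        by (rule integrable_ivl_bounded_mult[OF Hm Hb, of _ 1]) (auto simp: indicator_def)
      ultimately show ?thesis
        by (simp add: has_bochner_integral_iff)
    qed
    have "has_bochner_integral (ivl_measure 1)
        (\<lambda>y. \<Sum>n=1..N. \<Sum>j=1..J. (w n j * indicator (grid_cell T N n) s) * (H y * indicator (grid_cell 1 J j) y))
        (\<Sum>n=1..N. \<Sum>j=1..J. (w n j * indicator (grid_cell T N n) s) * (\<Sum>k. decay (?\<mu> k) t s * a k j))"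
      by (intro has_bochner_integral_sum has_bochner_integral_mult_right cellint)
    moreover have "heat_kernel (t - s) x y * discrete_load T N J W s y \<omega> =
        (\<Sum>n=1..N. \<Sum>j=1..J. (w n j * indicator (grid_cell T N n) s) * (H y * indicator (grid_cell 1 J j) y))" for y
      unfolding load H_def by (simp only: sum_distrib_left ac_simps)
    ultimately show ?thesis
      using True by (simp add: set_LINT_eq_restrict_space has_bochner_integral_iff mult.assoc
          del: sum_mult_indicator sum_indicator_mult)
  next
    case False
    then have "decay (?\<mu> k) t s = 0" for k
      by (auto simp: decay_def)
    then show ?thesis
      using False by simp
  qed
  have outer: "has_bochner_integral lborel (\<lambda>s. indicator (grid_cell T N n) s * (\<Sum>k. decay (?\<mu> k) t s * a k j))
      (dt * dx * kernel_avg T N J t x n j)" if n: "n \<in> {1..N}" and j: "j \<in> {1..J}" for n j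
  proof -
    let ?U = "restrict_space lborel (grid_cell T N n)"
    define A where "A = sqrt 2 * (dx * sqrt 2)"
    have aA: "\<bar>a k j\<bar> \<le> A" for k
      unfolding A_def by (rule a_bound[OF j])
    have \<mu>0: "0 \<le> ?\<mu> k" for k
      by simp
    have intd: "integrable ?U (decay (?\<mu> k) t)" for k
      unfolding grid_cell_def by (rule integrable_ivl_bounded[OF decay_measurable decay_bounded[OF \<mu>0]])
    have intk: "integrable ?U (\<lambda>s. decay (?\<mu> k) t s * a k j)" for k
      using intd by (rule integrable_mult_left)
    have val: "(LINT s|?U. decay (?\<mu> k) t s) = dt * cell_avg T N (decay (?\<mu> k) t) n" for k
      using pos unfolding cell_avg_def dt_def[symmetric] set_LINT_eq_restrict_space[OF grid_cell_measurable] by simp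
    have sm: "AE s in ?U. summable (\<lambda>k. norm (decay (?\<mu> k) t s * a k j))"
      using summable_decay_mult[OF aA] by simp
    have norms: "summable (\<lambda>k. LINT s|?U. norm (decay (?\<mu> k) t s * a k j))"
    proof -
      have "(LINT s|?U. norm (decay (?\<mu> k) t s * a k j)) = dt * (cell_avg T N (decay (?\<mu> k) t) n * \<bar>a k j\<bar>)" for k
      proof -
        have "(LINT s|?U. norm (decay (?\<mu> k) t s * a k j)) = (LINT s|?U. decay (?\<mu> k) t s * \<bar>a k j\<bar>)"
          by (simp add: abs_mult decay_nonneg)
        also have "\<dots> = (LINT s|?U. decay (?\<mu> k) t s) * \<bar>a k j\<bar>"
          by (rule integral_mult_left_zero)
        finally show ?thesis
          by (simp only: val ac_simps)
      qed
      moreover have "summable (\<lambda>k. dt * (cell_avg T N (decay (?\<mu> k) t) n * \<bar>a k j\<bar>))"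
      proof -
        have "summable (\<lambda>k. (dt * dx) * \<bar>?e k x * (cell_avg T N (decay (?\<mu> k) t) n * cell_avg 1 J (?e k) j)\<bar>)"
          by (intro summable_mult summable_cell_avg_products[OF T n j, of "\<lambda>k. ?e k x", OF eigfun_bounded])
        then show ?thesis
          using pos cell_avg_decay_bounds(1)[OF eigval_Suc_pos T]
          by (simp add: a_def abs_mult ac_simps)
      qed
      ultimately show ?thesis
        by simp
    qed
    have integ: "integrable ?U (\<lambda>s. \<Sum>k. decay (?\<mu> k) t s * a k j)"
      by (rule integrable_suminf[OF intk sm norms])
    have "(LINT s|?U. (\<Sum>k. decay (?\<mu> k) t s * a k j)) = (\<Sum>k. LINT s|?U. decay (?\<mu> k) t s * a k j)"
      by (rule integral_suminf[OF intk sm norms])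
    also have "\<dots> = (\<Sum>k. (dt * dx) * (?e k x * (cell_avg T N (decay (?\<mu> k) t) n * cell_avg 1 J (?e k) j)))"
      unfolding integral_mult_left_zero val a_def by (simp only: ac_simps)
    also have "\<dots> = dt * dx * kernel_avg T N J t x n j"
      unfolding kernel_avg_def
      by (rule suminf_mult[OF summable_rabs_cancel[OF
            summable_cell_avg_products[OF T n j, of "\<lambda>k. ?e k x", OF eigfun_bounded]]])
    finally have "has_bochner_integral ?U (\<lambda>s. \<Sum>k. decay (?\<mu> k) t s * a k j) (dt * dx * kernel_avg T N J t x n j)"
      using integ by (simp add: has_bochner_integral_iff)
    then show ?thesis
      by (simp add: has_bochner_integral_iff integrable_restrict_space integral_restrict_space)
  qed
  have "has_bochner_integral lborel
      (\<lambda>s. \<Sum>n=1..N. \<Sum>j=1..J. w n j * (indicator (grid_cell T N n) s * (\<Sum>k. decay (?\<mu> k) t s * a k j)))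
      (\<Sum>n=1..N. \<Sum>j=1..J. w n j * (dt * dx * kernel_avg T N J t x n j))"
    by (intro has_bochner_integral_sum has_bochner_integral_mult_right outer)
  then have "regularized_solution T N J W t x \<omega> = (\<Sum>n=1..N. \<Sum>j=1..J. w n j * (dt * dx * kernel_avg T N J t x n j))"
    unfolding regularized_solution_def set_lebesgue_integral_def[of _ "{0<..<t}"] inner
    by (rule has_bochner_integral_integral_eq)
  also have "\<dots> = (\<Sum>n=1..N. \<Sum>j=1..J. kernel_avg T N J t x n j * W (cell T N J n j) \<omega>)"
    using pos by (simp add: w_def ac_simps)
  finally show ?thesis .
qed

section \<open>The mean square error as a sum over the modes\<close>

lemma step_proj_product:
  "step_proj T N g s * step_proj 1 J e y =
    (\<Sum>n=1..N. \<Sum>j=1..J. cell_avg T N g n * cell_avg 1 J e j * indicator (cell T N J n j) (s, y))"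
  unfolding step_proj_def sum_product cell_eq_Times indicator_times by (simp only: fst_conv snd_conv ac_simps)

text \<open>The mode with index \<open>k\<close> of the integrand of the mild solution, minus its projection.\<close>

definition mode_defect :: "real \<Rightarrow> nat \<Rightarrow> nat \<Rightarrow> real \<Rightarrow> nat \<Rightarrow> real \<Rightarrow> real \<Rightarrow> real" where
  "mode_defect T N J t k s y =
     decay ((eigval k)\<^sup>2) t s * eigfun k y -
     step_proj T N (decay ((eigval k)\<^sup>2) t) s * step_proj 1 J (eigfun k) y"

lemma mode_defect_measurable [measurable]:
  "(\<lambda>(s, y). mode_defect T N J t k s y) \<in> borel_measurable (borel \<Otimes>\<^sub>M borel)"
  unfolding mode_defect_def[abs_def] by measurable

text \<open>Only the factor \<open>eigfun (Suc k) x\<close> of a mode depends on \<open>x\<close>, so for fixed \<open>(s, y)\<close> the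
  difference between the integrand and its cell averages is a sine series in \<open>x\<close>, to which Parseval's identity applies.\<close>

lemma kernel_defect_series:
  assumes T: "0 < T"
  shows "summable (\<lambda>k. \<bar>mode_defect T N J t (Suc k) s y\<bar>)"
    and "indicator {0<..<t} s * heat_kernel (t - s) x y -
        (\<Sum>n=1..N. \<Sum>j=1..J. kernel_avg T N J t x n j * indicator (cell T N J n j) (s, y)) =
      (\<Sum>k. eigfun (Suc k) x * mode_defect T N J t (Suc k) s y)"
proof -
  let ?d = "\<lambda>k. decay ((eigval (Suc k))\<^sup>2) t" and ?e = "\<lambda>k. eigfun (Suc k)"
  let ?A = "\<lambda>k n j. cell_avg T N (?d k) n * cell_avg 1 J (?e k) j"
  let ?i = "\<lambda>n j. indicator (cell T N J n j) (s, y) :: real"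
  have split: "c k * mode_defect T N J t (Suc k) s y =
      ?d k s * (c k * ?e k y) - (\<Sum>n=1..N. \<Sum>j=1..J. c k * ?A k n j * ?i n j)" for c :: "nat \<Rightarrow> real" and k
    unfolding mode_defect_def step_proj_product right_diff_distrib sum_distrib_left by (simp only: ac_simps)
  have s1: "summable (\<lambda>k. \<bar>?d k s * (c k * ?e k y)\<bar>)" if c: "\<And>k. \<bar>c k\<bar> \<le> B" for c B
  proof (rule summable_decay_mult)
    show "\<bar>c k * ?e k y\<bar> \<le> B * sqrt 2" for k
      unfolding abs_mult using c[of k] by (intro mult_mono eigfun_bounded) (auto intro: order_trans[OF abs_ge_zero])
  qed
  have s2: "summable (\<lambda>k. c k * ?A k n j * ?i n j)"
    if c: "\<And>k. \<bar>c k\<bar> \<le> B" and nj: "n \<in> {1..N}" "j \<in> {1..J}" for c B n j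
    by (rule summable_mult2[OF summable_rabs_cancel[OF summable_cell_avg_products[OF T nj c]]])
  show "summable (\<lambda>k. \<bar>mode_defect T N J t (Suc k) s y\<bar>)"
  proof -
    have "summable (\<lambda>k. \<bar>\<Sum>n=1..N. \<Sum>j=1..J. 1 * ?A k n j * ?i n j\<bar>)"
    proof (rule summable_comparison_test')
      show "summable (\<lambda>k. \<Sum>n=1..N. \<Sum>j=1..J. \<bar>1 * ?A k n j\<bar>)"
        by (intro summable_sum summable_cell_avg_products[OF T, of _ _ _ _ _ 1]) auto
      show "norm \<bar>\<Sum>n=1..N. \<Sum>j=1..J. 1 * ?A k n j * ?i n j\<bar> \<le> (\<Sum>n=1..N. \<Sum>j=1..J. \<bar>1 * ?A k n j\<bar>)" for k
      proof -
        have "\<bar>\<Sum>n=1..N. \<Sum>j=1..J. 1 * ?A k n j * ?i n j\<bar> \<le> (\<Sum>n=1..N. \<Sum>j=1..J. \<bar>1 * ?A k n j * ?i n j\<bar>)"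
          by (rule order_trans[OF sum_abs]) (intro sum_mono sum_abs)
        also have "\<dots> \<le> (\<Sum>n=1..N. \<Sum>j=1..J. \<bar>1 * ?A k n j\<bar>)"
          by (intro sum_mono) (auto simp: indicator_def)
        finally show ?thesis
          by simp
      qed
    qed
    then have "summable (\<lambda>k. \<bar>?d k s * (1 * ?e k y)\<bar> + \<bar>\<Sum>n=1..N. \<Sum>j=1..J. 1 * ?A k n j * ?i n j\<bar>)"
      by (intro summable_add s1[of "\<lambda>_. 1" 1]) auto
    then show ?thesis
    proof (rule summable_comparison_test')
      show "norm \<bar>mode_defect T N J t (Suc k) s y\<bar> \<le>
          \<bar>?d k s * (1 * ?e k y)\<bar> + \<bar>\<Sum>n=1..N. \<Sum>j=1..J. 1 * ?A k n j * ?i n j\<bar>" for k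
        using split[of "\<lambda>_. 1" k] abs_triangle_ineq4[of "?d k s * (1 * ?e k y)" "\<Sum>n=1..N. \<Sum>j=1..J. 1 * ?A k n j * ?i n j"]
        by (simp only: mult_1_left real_norm_def abs_abs)
    qed
  qed
  have e: "\<And>k. \<bar>?e k x\<bar> \<le> sqrt 2"
    by (rule eigfun_bounded)
  note S1 = summable_rabs_cancel[OF s1[of "\<lambda>k. ?e k x", OF e]] and S2 = s2[of "\<lambda>k. ?e k x", OF e]
  have S2': "summable (\<lambda>k. \<Sum>n=1..N. \<Sum>j=1..J. ?e k x * ?A k n j * ?i n j)"
    by (intro summable_sum S2)
  have "(\<Sum>k. ?e k x * mode_defect T N J t (Suc k) s y) =
      (\<Sum>k. ?d k s * (?e k x * ?e k y)) - (\<Sum>k. \<Sum>n=1..N. \<Sum>j=1..J. ?e k x * ?A k n j * ?i n j)"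
    unfolding split[of "\<lambda>k. ?e k x"] by (rule suminf_diff[OF S1 S2', symmetric])
  also have "(\<Sum>k. \<Sum>n=1..N. \<Sum>j=1..J. ?e k x * ?A k n j * ?i n j) =
      (\<Sum>n=1..N. \<Sum>k. \<Sum>j=1..J. ?e k x * ?A k n j * ?i n j)"
    by (rule suminf_sum) (intro summable_sum S2)
  also have "\<dots> = (\<Sum>n=1..N. \<Sum>j=1..J. \<Sum>k. ?e k x * ?A k n j * ?i n j)"
    by (intro sum.cong refl suminf_sum S2)
  also have "\<dots> = (\<Sum>n=1..N. \<Sum>j=1..J. kernel_avg T N J t x n j * ?i n j)"
    unfolding kernel_avg_def
    by (intro sum.cong refl) (rule suminf_mult2[symmetric, OF summable_rabs_cancel[OF summable_cell_avg_products[OF T _ _ e]]])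
  finally show "indicator {0<..<t} s * heat_kernel (t - s) x y -
        (\<Sum>n=1..N. \<Sum>j=1..J. kernel_avg T N J t x n j * ?i n j) =
      (\<Sum>k. ?e k x * mode_defect T N J t (Suc k) s y)"
    unfolding heat_kernel_eq_decay_series by simp
qed

lemma spacetime_measurable [measurable]: "spacetime T \<in> sets borel"
  unfolding spacetime_def borel_prod[symmetric] by measurable

lemma emeasure_spacetime_finite: "emeasure lborel (spacetime T) < \<infinity>"
  unfolding spacetime_def by (intro emeasure_bounded_finite bounded_Times) auto

lemma cell_subset_spacetime:
  assumes "0 < T" "n \<in> {1..N}" "j \<in> {1..J}"
  shows "cell T N J n j \<subseteq> spacetime T"
  using grid_cell_subset[OF assms(1,2)] grid_cell_subset[OF zero_less_one assms(3)]
  unfolding cell_eq_Times spacetime_def by auto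

lemma cell_measurable [measurable]: "cell T N J n j \<in> sets borel"
  unfolding cell_eq_Times borel_prod[symmetric] by measurable

lemma nn_integral_spacetime:
  fixes F :: "real \<Rightarrow> real \<Rightarrow> ennreal"
  assumes F: "(\<lambda>(s, y). F s y) \<in> borel_measurable (borel \<Otimes>\<^sub>M borel)"
  shows "(\<integral>\<^sup>+ z. (case z of (s, y) \<Rightarrow> F s y) \<partial>restrict_space lborel (spacetime T)) =
    (\<integral>\<^sup>+ s. (\<integral>\<^sup>+ y. F s y \<partial>ivl_measure 1) \<partial>ivl_measure T)"
proof -
  have [measurable]: "(\<lambda>(s, y). F s y) \<in> borel_measurable (lborel \<Otimes>\<^sub>M lborel)"
    using F by simp
  have [measurable]: "(\<lambda>z. (case z of (s, y) \<Rightarrow> F s y) * indicator (spacetime T) z) \<in> borel_measurable (lborel \<Otimes>\<^sub>M lborel)"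
    unfolding spacetime_def by measurable
  have ne: "AE s in lborel. s \<noteq> (0::real)" "AE s in lborel. s \<noteq> T"
    by (auto intro: AE_lborel_singleton)
  have "(\<integral>\<^sup>+ z. (case z of (s, y) \<Rightarrow> F s y) \<partial>restrict_space lborel (spacetime T)) =
      (\<integral>\<^sup>+ z. (case z of (s, y) \<Rightarrow> F s y) * indicator (spacetime T) z \<partial>(lborel \<Otimes>\<^sub>M lborel))"
    by (subst nn_integral_restrict_space) (simp_all add: lborel_prod)
  also have "\<dots> = (\<integral>\<^sup>+ s. (\<integral>\<^sup>+ y. F s y * indicator (spacetime T) (s, y) \<partial>lborel) \<partial>lborel)"
    by (subst lborel.nn_integral_fst[symmetric]) simp_all
  also have "\<dots> = (\<integral>\<^sup>+ s. (\<integral>\<^sup>+ y. F s y * indicator {0<..<1} y \<partial>lborel) * indicator {0<..<T} s \<partial>lborel)"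
  proof (rule nn_integral_cong_AE)
    show "AE s in lborel. (\<integral>\<^sup>+ y. F s y * indicator (spacetime T) (s, y) \<partial>lborel) =
        (\<integral>\<^sup>+ y. F s y * indicator {0<..<1} y \<partial>lborel) * indicator {0<..<T} s"
      using ne
    proof eventually_elim
      case (elim s)
      show ?case
        using elim by (cases "s \<in> {0<..<T}") (auto simp: spacetime_def indicator_def intro!: nn_integral_cong)
    qed
  qed
  also have "\<dots> = (\<integral>\<^sup>+ s. (\<integral>\<^sup>+ y. F s y \<partial>ivl_measure 1) \<partial>ivl_measure T)"
    by (simp add: nn_integral_restrict_space)
  finally show ?thesis .
qed

lemma nn_integral_mode_defect:
  assumes T: "0 < T" and t: "0 \<le> t" "t \<le> T"
  shows "(\<integral>\<^sup>+ z. (case z of (s, y) \<Rightarrow> ennreal ((mode_defect T N J t (Suc k) s y)\<^sup>2)) \<partial>restrict_space lborel (spacetime T)) =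
    ennreal (mode_error T N J (Suc k) t)"
proof -
  let ?\<mu> = "(eigval (Suc k))\<^sup>2"
  have \<mu>: "0 < ?\<mu>" "0 \<le> ?\<mu>"
    by (rule eigval_Suc_pos) simp
  have sq: "has_bochner_integral (ivl_measure L) (\<lambda>s. (g s)\<^sup>2) (LINT s|ivl_measure L. (g s)\<^sup>2)"
    if "g \<in> borel_measurable borel" "\<And>s. \<bar>g s\<bar> \<le> B" for L B and g :: "real \<Rightarrow> real"
    using integrable_ivl_bounded_mult[OF that that] by (simp add: has_bochner_integral_iff power2_eq_square)
  have "(\<integral>\<^sup>+ z. (case z of (s, y) \<Rightarrow> ennreal ((mode_defect T N J t (Suc k) s y)\<^sup>2)) \<partial>restrict_space lborel (spacetime T)) =
      (\<integral>\<^sup>+ s. (\<integral>\<^sup>+ y. ennreal ((mode_defect T N J t (Suc k) s y)\<^sup>2) \<partial>ivl_measure 1) \<partial>ivl_measure T)"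
    by (rule nn_integral_spacetime) measurable
  also have "\<dots> = ennreal ((LINT s|ivl_measure T. (decay ?\<mu> t s)\<^sup>2) * (LINT y|ivl_measure 1. (eigfun (Suc k) y)\<^sup>2) -
      proj_energy T N (decay ?\<mu> t) * proj_energy 1 J (eigfun (Suc k)))"
    unfolding mode_defect_def
    by (intro nn_integral_tensor_projection_error sq[OF decay_measurable decay_bounded[OF \<mu>(2)]]
        sq[OF eigfun_measurable eigfun_bounded] T zero_less_one
        step_proj_inner[OF decay_measurable decay_bounded[OF \<mu>(2)]]
        step_proj_inner[OF eigfun_measurable eigfun_bounded])
  also have "\<dots> = ennreal (mode_error T N J (Suc k) t)"
    unfolding mode_error_def eigfun_norm decay_norm[OF \<mu>(1) t T] by simp
  finally show ?thesis .
qed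

lemma measurable_pair_restrict_space:
  assumes f: "f \<in> measurable (A \<Otimes>\<^sub>M B) C"
  shows "f \<in> measurable (restrict_space A S \<Otimes>\<^sub>M restrict_space B S') C"
proof -
  have "(\<lambda>z. (fst z, snd z)) \<in> measurable (restrict_space A S \<Otimes>\<^sub>M restrict_space B S') (A \<Otimes>\<^sub>M B)"
    by (intro measurable_Pair measurable_compose[OF measurable_fst] measurable_compose[OF measurable_snd]
        measurable_restrict_space1 measurable_ident_sets refl)
  from measurable_compose[OF this f] show ?thesis
    by simp
qed

text \<open>By the isometry the error at a point \<open>x\<close> is the squared distance of the integrand to its cell
  averages. Integration over \<open>x\<close> turns it into a sum over the modes.\<close>

lemma mean_square_error_eq:
  assumes M: "prob_space M" and T: "0 < T" and W: "white_noise M (spacetime T) W"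
    and u: "mild_solution M T W u" and N: "1 \<le> N" and J: "1 \<le> J" and t: "t \<in> {0..T}"
  shows "(\<integral>\<^sup>+ \<omega>. (\<integral>\<^sup>+ x\<in>{0<..<1}. ennreal ((u t x \<omega> - regularized_solution T N J W t x \<omega>)\<^sup>2) \<partial>lborel) \<partial>M) =
    (\<Sum>k. ennreal (mode_error T N J (Suc k) t))"
proof -
  interpret prob_space M
    by fact
  let ?Q = "restrict_space lborel (spacetime T)"
  let ?v = "\<lambda>x \<omega>. \<Sum>n=1..N. \<Sum>j=1..J. kernel_avg T N J t x n j * W (cell T N J n j) \<omega>"
  let ?f = "\<lambda>x s y. indicator {0<..<t} s * heat_kernel (t - s) x y"
  let ?g = "\<lambda>x s y. \<Sum>n=1..N. \<Sum>j=1..J. kernel_avg T N J t x n j * indicator (cell T N J n j) (s, y)"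
  have u_meas: "(\<lambda>(x, \<omega>). u t x \<omega>) \<in> borel_measurable (restrict_space borel {0..1} \<Otimes>\<^sub>M M)"
    and u_int: "\<And>x. x \<in> {0..1} \<Longrightarrow> has_wiener_integral M (spacetime T) W (\<lambda>(s, y). ?f x s y) (u t x)"
    using u t by (auto simp: mild_solution_def)
  have W_meas [measurable]: "W (cell T N J n j) \<in> borel_measurable M" if "n \<in> {1..N}" "j \<in> {1..J}" for n j
    by (rule white_noise_measurable[OF W cell_measurable cell_subset_spacetime[OF T that]])
  have sf: "sigma_finite_measure (ivl_measure 1)" "sigma_finite_measure M"
    using finite_measure_ivl by (auto intro: finite_measure.axioms sigma_finite_measure_axioms)
  interpret xw: pair_sigma_finite "ivl_measure 1" M
    using sf by (simp add: pair_sigma_finite_def)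
  have "finite_measure ?Q"
    using emeasure_spacetime_finite[of T]
    by (intro finite_measureI) (simp add: emeasure_restrict_space space_restrict_space less_top)
  then interpret xz: pair_sigma_finite "ivl_measure 1" ?Q
    using sf by (simp add: pair_sigma_finite_def finite_measure.axioms)
  have emb: "(\<lambda>z. (fst z, snd z)) \<in> measurable (ivl_measure 1 \<Otimes>\<^sub>M M) (restrict_space borel {0..1} \<Otimes>\<^sub>M M)"
  proof (intro measurable_Pair measurable_compose[OF measurable_fst] measurable_snd)
    show "(\<lambda>x. x) \<in> measurable (ivl_measure 1) (restrict_space borel {0..1})"
      by (intro measurable_restrict_space2 measurable_restrict_space1) (auto simp: space_restrict_space)
  qed
  have mu: "(\<lambda>z. u t (fst z) (snd z)) \<in> borel_measurable (ivl_measure 1 \<Otimes>\<^sub>M M)"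
    using measurable_compose[OF emb u_meas] by simp
  have mv: "(\<lambda>z. ?v (fst z) (snd z)) \<in> borel_measurable (ivl_measure 1 \<Otimes>\<^sub>M M)"
  proof (intro borel_measurable_sum borel_measurable_times)
    fix n j assume nj: "n \<in> {1..N}" "j \<in> {1..J}"
    show "(\<lambda>z. kernel_avg T N J t (fst z) n j) \<in> borel_measurable (ivl_measure 1 \<Otimes>\<^sub>M M)"
      by (intro measurable_compose[OF measurable_fst] measurable_restrict_space1) simp
    show "(\<lambda>z. W (cell T N J n j) (snd z)) \<in> borel_measurable (ivl_measure 1 \<Otimes>\<^sub>M M)"
      by (rule measurable_compose[OF measurable_snd W_meas[OF nj]])
  qed
  have m1: "(\<lambda>(x, \<omega>). ennreal ((u t x \<omega> - ?v x \<omega>)\<^sup>2)) \<in> borel_measurable (ivl_measure 1 \<Otimes>\<^sub>M M)"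
    unfolding case_prod_beta' by (intro measurable_compose[OF _ measurable_ennreal] borel_measurable_power borel_measurable_diff mu mv)
  have m2: "(\<lambda>(x, z). (case z of (s, y) \<Rightarrow> ennreal ((?f x s y - ?g x s y)\<^sup>2))) \<in>
      borel_measurable (ivl_measure 1 \<Otimes>\<^sub>M ?Q)"
  proof (rule measurable_pair_restrict_space)
    have "(\<lambda>(x, z). (case z of (s, y) \<Rightarrow> ennreal ((?f x s y - ?g x s y)\<^sup>2))) \<in>
        borel_measurable (borel \<Otimes>\<^sub>M (borel \<Otimes>\<^sub>M borel))"
      unfolding cell_eq_Times by measurable
    moreover have "sets (lborel :: (real \<times> real) measure) = sets (borel \<Otimes>\<^sub>M borel)"
      unfolding borel_prod by (rule sets_lborel)
    then have sets_eq: "sets (lborel \<Otimes>\<^sub>M lborel :: (real \<times> real \<times> real) measure) = sets (borel \<Otimes>\<^sub>M (borel \<Otimes>\<^sub>M borel))"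
      by (intro sets_pair_measure_cong sets_lborel)
    ultimately show "(\<lambda>(x, z). (case z of (s, y) \<Rightarrow> ennreal ((?f x s y - ?g x s y)\<^sup>2))) \<in> borel_measurable (lborel \<Otimes>\<^sub>M lborel)"
      by (simp only: measurable_cong_sets[OF sets_eq refl])
  qed
  have pointwise: "(\<integral>\<^sup>+ \<omega>. ennreal ((u t x \<omega> - ?v x \<omega>)\<^sup>2) \<partial>M) =
      (\<integral>\<^sup>+ z. (case z of (s, y) \<Rightarrow> ennreal ((?f x s y - ?g x s y)\<^sup>2)) \<partial>?Q)" if x: "x \<in> {0..1}" for x
  proof -
    have "(\<integral>\<^sup>+ \<omega>. ennreal ((u t x \<omega> - (\<Sum>i\<in>{1..N} \<times> {1..J}. (case i of (n, j) \<Rightarrow> kernel_avg T N J t x n j) *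
          W (case i of (n, j) \<Rightarrow> cell T N J n j) \<omega>))\<^sup>2) \<partial>M) =
        (\<integral>\<^sup>+ z. ennreal (((\<lambda>(s, y). ?f x s y) z - (\<Sum>i\<in>{1..N} \<times> {1..J}. (case i of (n, j) \<Rightarrow> kernel_avg T N J t x n j) *
          indicator (case i of (n, j) \<Rightarrow> cell T N J n j) z))\<^sup>2) \<partial>?Q)"
    proof (rule wiener_integral_isometry[OF W u_int[OF x]])
      show "(case i of (n, j) \<Rightarrow> cell T N J n j) \<subseteq> spacetime T" if "i \<in> {1..N} \<times> {1..J}" for i
        using that cell_subset_spacetime[OF T] by (cases i) auto
      show "(case i of (n, j) \<Rightarrow> cell T N J n j) \<in> sets borel" if "i \<in> {1..N} \<times> {1..J}" for i
        by (cases i) (simp add: cell_measurable)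
    qed (use emeasure_spacetime_finite[of T] in auto)
    then show ?thesis
      by (simp only: sum.cartesian_product split_beta' prod.collapse)
  qed
  have "(\<integral>\<^sup>+ \<omega>. (\<integral>\<^sup>+ x\<in>{0<..<1}. ennreal ((u t x \<omega> - regularized_solution T N J W t x \<omega>)\<^sup>2) \<partial>lborel) \<partial>M) =
      (\<integral>\<^sup>+ \<omega>. (\<integral>\<^sup>+ x. ennreal ((u t x \<omega> - ?v x \<omega>)\<^sup>2) \<partial>ivl_measure 1) \<partial>M)"
    by (simp only: regularized_solution_eq[OF T t N J]) (simp add: nn_integral_restrict_space)
  also have "\<dots> = (\<integral>\<^sup>+ x. (\<integral>\<^sup>+ \<omega>. ennreal ((u t x \<omega> - ?v x \<omega>)\<^sup>2) \<partial>M) \<partial>ivl_measure 1)"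
    by (rule xw.Fubini'[OF m1])
  also have "\<dots> = (\<integral>\<^sup>+ x. (\<integral>\<^sup>+ z. (case z of (s, y) \<Rightarrow> ennreal ((?f x s y - ?g x s y)\<^sup>2)) \<partial>?Q) \<partial>ivl_measure 1)"
    by (intro nn_integral_cong pointwise) (auto simp: space_restrict_space)
  also have "\<dots> = (\<integral>\<^sup>+ z. (\<integral>\<^sup>+ x. (case z of (s, y) \<Rightarrow> ennreal ((?f x s y - ?g x s y)\<^sup>2)) \<partial>ivl_measure 1) \<partial>?Q)"
    by (rule xz.Fubini'[OF m2, symmetric])
  also have "\<dots> = (\<integral>\<^sup>+ z. (\<Sum>k. (case z of (s, y) \<Rightarrow> ennreal ((mode_defect T N J t (Suc k) s y)\<^sup>2))) \<partial>?Q)"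
    by (intro nn_integral_cong)
       (simp only: split_beta' kernel_defect_series(2)[OF T] nn_integral_sine_series_square[OF kernel_defect_series(1)[OF T]])
  also have "\<dots> = (\<Sum>k. \<integral>\<^sup>+ z. (case z of (s, y) \<Rightarrow> ennreal ((mode_defect T N J t (Suc k) s y)\<^sup>2)) \<partial>?Q)"
  proof (rule nn_integral_suminf)
    fix k
    have "(\<lambda>(s, y). ennreal ((mode_defect T N J t (Suc k) s y)\<^sup>2)) \<in> borel_measurable (borel \<Otimes>\<^sub>M borel)"
      by measurable
    then show "(\<lambda>z. case z of (s, y) \<Rightarrow> ennreal ((mode_defect T N J t (Suc k) s y)\<^sup>2)) \<in> borel_measurable ?Q"
      by (intro measurable_restrict_space1) (simp add: borel_prod)
  qed
  also have "\<dots> = (\<Sum>k. ennreal (mode_error T N J (Suc k) t))"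
    using t by (simp only: nn_integral_mode_defect[OF T] atLeastAtMost_iff)
  finally show ?thesis .
qed

section \<open>Attainment of the maximum and the convergence rate\<close>

lemma modeling_error_eq:
  assumes M: "prob_space M" and T: "0 < T" and W: "white_noise M (spacetime T) W"
    and u: "mild_solution M T W u" and N: "1 \<le> N" and J: "1 \<le> J" and t: "t \<in> {0..T}"
  shows "modeling_error M u (regularized_solution T N J W) t = ennreal (sqrt (\<Sum>k. mode_error T N J (Suc k) t))"
proof -
  have t': "0 \<le> t" "t \<le> T"
    using t by auto
  have "summable (\<lambda>k. 1 / 2 * (1 / (eigval (Suc k))\<^sup>2))"
    by (rule summable_mult[OF summable_inverse_eigval_square])
  then have sm: "summable (\<lambda>k. mode_error T N J (Suc k) t)"
    by (rule summable_comparison_test') (use mode_error_bounds(1,2)[OF T t'] in simp)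
  have "(\<Sum>k. ennreal (mode_error T N J (Suc k) t)) = ennreal (\<Sum>k. mode_error T N J (Suc k) t)"
    using mode_error_bounds(1)[OF T t'] sm by (intro suminf_ennreal2)
  then show ?thesis
    unfolding modeling_error_def mean_square_error_eq[OF M T W u N J t]
    using suminf_nonneg[OF sm mode_error_bounds(1)[OF T t']] by (simp add: ennsqrt_def)
qed

text \<open>The modes are dominated by a summable sequence that does not depend on \<open>t\<close>, hence the series
  converges uniformly. This is what makes the maximum over \<open>t\<close> attained.\<close>

lemma continuous_on_mode_error_sum:
  assumes T: "0 < T"
  shows "continuous_on {0..T} (\<lambda>t. \<Sum>k. mode_error T N J (Suc k) t)"
proof -
  have "uniform_limit {0..T} (\<lambda>n t. \<Sum>k<n. mode_error T N J (Suc k) t)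
      (\<lambda>t. \<Sum>k. mode_error T N J (Suc k) t) sequentially"
  proof (rule Weierstrass_m_test)
    show "summable (\<lambda>k. 1 / 2 * (1 / (eigval (Suc k))\<^sup>2))"
      by (rule summable_mult[OF summable_inverse_eigval_square])
    show "norm (mode_error T N J (Suc k) t) \<le> 1 / 2 * (1 / (eigval (Suc k))\<^sup>2)" if "t \<in> {0..T}" for k t
      using mode_error_bounds(1,2)[OF T, of t N J k] that by simp
  qed
  then show ?thesis
    by (rule uniform_limit_theorem[rotated])
       (auto intro!: continuous_on_sum continuous_on_mode_error[OF T] always_eventually)
qed

lemma mode_error_sum_le:
  assumes T: "0 < T" and t: "0 \<le> t" "t \<le> T" and N: "1 \<le> N" and J: "1 \<le> J"
  shows "(\<Sum>k. mode_error T N J (Suc k) t) \<le> 2 * pi * sqrt (T / real N) + pi * (1 / real J)"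
proof -
  let ?m = "\<lambda>r k. min (r\<^sup>2) (1 / (real (Suc k))\<^sup>2)"
  let ?r = "2 * sqrt (T / real N)" and ?r' = "1 / real J"
  have pos: "0 < ?r" "0 < ?r'"
    using T N J by auto
  note s = suminf_min_inverse_square_le[OF pos(1)] and s' = suminf_min_inverse_square_le[OF pos(2)]
  have sum: "summable (\<lambda>k. ?m ?r k + ?m ?r' k)"
    by (rule summable_add[OF s(1) s'(1)])
  have le: "mode_error T N J (Suc k) t \<le> ?m ?r k + ?m ?r' k" for k
    by (rule mode_error_bounds(3)[OF T t N J])
  have "summable (\<lambda>k. mode_error T N J (Suc k) t)"
    by (rule summable_comparison_test'[OF sum]) (use le mode_error_bounds(1)[OF T t] in simp)
  then have "(\<Sum>k. mode_error T N J (Suc k) t) \<le> (\<Sum>k. ?m ?r k + ?m ?r' k)"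
    by (intro suminf_le le sum)
  also have "\<dots> = (\<Sum>k. ?m ?r k) + (\<Sum>k. ?m ?r' k)"
    by (rule suminf_add[OF s(1) s'(1), symmetric])
  also have "\<dots> \<le> pi * ?r + pi * ?r'"
    by (intro add_mono s(2) s'(2))
  finally show ?thesis
    by simp
qed

text \<open>The mode sums give the rate \<open>1/2\<close> in space; for mesh sizes at most 1 the rate
  \<open>1/2 - \<epsilon>\<close> is weaker, and the factor \<open>\<epsilon> powr (-1/2)\<close> exceeds 1. The constant is 3
  because \<open>2 \<pi> < 9\<close>.\<close>

lemma sqrt_rate_le:
  fixes dt dx \<epsilon> :: real
  assumes dt: "0 < dt" and dx: "0 < dx" "dx \<le> 1" and \<epsilon>: "0 < \<epsilon>" "\<epsilon> \<le> 1 / 2"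
    and S: "S \<le> 2 * pi * sqrt dt + pi * dx"
  shows "sqrt S \<le> 3 * (dt powr (1/4) + \<epsilon> powr (-1/2) * dx powr (1/2 - \<epsilon>))"
proof -
  let ?a = "dt powr (1/4)" and ?b = "dx powr (1/2)"
  have a: "?a\<^sup>2 = sqrt dt"
    using dt by (simp add: powr_half_sqrt[symmetric] powr_powr power2_eq_square powr_add[symmetric])
  have b: "?b\<^sup>2 = dx"
    using dx by (simp add: power2_eq_square powr_add[symmetric])
  have "S \<le> 9 * ?a\<^sup>2 + 9 * ?b\<^sup>2"
  proof -
    have "2 * pi * sqrt dt \<le> 9 * sqrt dt" "pi * dx \<le> 9 * dx"
      using pi_less_4 dt dx by (auto intro!: mult_right_mono)
    then show ?thesis
      using S unfolding a b by linarith
  qed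
  also have "\<dots> \<le> (3 * (?a + ?b))\<^sup>2"
    by (simp add: power2_eq_square algebra_simps)
  finally have "sqrt S \<le> 3 * (?a + ?b)"
    by (intro real_le_lsqrt) auto
  also have "\<dots> \<le> 3 * (?a + \<epsilon> powr (-1/2) * dx powr (1/2 - \<epsilon>))"
  proof -
    have "1 powr (-1/2) \<le> \<epsilon> powr (-1/2)"
      using \<epsilon> by (intro powr_mono2') auto
    moreover have "?b \<le> dx powr (1/2 - \<epsilon>)"
      using dx \<epsilon> by (intro powr_mono') auto
    ultimately have "1 * ?b \<le> \<epsilon> powr (-1/2) * dx powr (1/2 - \<epsilon>)"
      by (intro mult_mono) auto
    then show ?thesis
      by simp
  qed
  finally show ?thesis .
qed

theorem theorem3p1:
  fixes M :: "'a measure" and T :: real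
    and W :: "(real \<times> real) set \<Rightarrow> 'a \<Rightarrow> real"
    and u :: "real \<Rightarrow> real \<Rightarrow> 'a \<Rightarrow> real"
  assumes "prob_space M" and "complete_measure M"
    and "0 < T"
    and "white_noise M (spacetime T) W"
    and "mild_solution M T W u"
  shows "\<exists>C::real. 0 < C \<and>
    (\<forall>N\<ge>1. \<forall>J\<ge>1.
       let Z = modeling_error M u (regularized_solution T N J W);
           dt = T / real N; dx = 1 / real J
       in \<exists>\<tau>\<in>{0..T}. (\<forall>t\<in>{0..T}. Z t \<le> Z \<tau>) \<and>
            (\<forall>\<epsilon>\<in>{0<..1/2}.
               Z \<tau> \<le> ennreal (C * (dt powr (1/4) + \<epsilon> powr (-1/2) * dx powr (1/2 - \<epsilon>)))))"
proof -
  have main: "\<exists>\<tau>\<in>{0..T}. (\<forall>t\<in>{0..T}. modeling_error M u (regularized_solution T N J W) t \<le>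
        modeling_error M u (regularized_solution T N J W) \<tau>) \<and>
      (\<forall>\<epsilon>\<in>{0<..1/2}. modeling_error M u (regularized_solution T N J W) \<tau> \<le>
        ennreal (3 * ((T / real N) powr (1/4) + \<epsilon> powr (-1/2) * (1 / real J) powr (1/2 - \<epsilon>))))"
    if N: "1 \<le> N" and J: "1 \<le> J" for N J
  proof -
    let ?S = "\<lambda>t. \<Sum>k. mode_error T N J (Suc k) t"
    have "{0..T} \<noteq> {}"
      using assms(3) by auto
    then obtain \<tau> where \<tau>: "\<tau> \<in> {0..T}" and max: "\<forall>t\<in>{0..T}. ?S t \<le> ?S \<tau>"
      using continuous_attains_sup[OF compact_Icc _ continuous_on_mode_error_sum[OF assms(3)]] by blast
    note eq = modeling_error_eq[OF assms(1,3,4,5) N J]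
    have "?S \<tau> \<le> 2 * pi * sqrt (T / real N) + pi * (1 / real J)"
      using \<tau> by (intro mode_error_sum_le assms N J) auto
    then have bound: "sqrt (?S \<tau>) \<le> 3 * ((T / real N) powr (1/4) + \<epsilon> powr (-1/2) * (1 / real J) powr (1/2 - \<epsilon>))"
      if "\<epsilon> \<in> {0<..1/2}" for \<epsilon>
      using assms(3) N J that by (intro sqrt_rate_le) auto
    show ?thesis
    proof (intro bexI[of _ \<tau>] conjI ballI)
      fix t assume t: "t \<in> {0..T}"
      show "modeling_error M u (regularized_solution T N J W) t \<le> modeling_error M u (regularized_solution T N J W) \<tau>"
        unfolding eq[OF t] eq[OF \<tau>] using max t by (intro ennreal_leI real_sqrt_le_mono) auto
    next
      fix \<epsilon> :: real assume "\<epsilon> \<in> {0<..1/2}"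
      then show "modeling_error M u (regularized_solution T N J W) \<tau> \<le>
          ennreal (3 * ((T / real N) powr (1/4) + \<epsilon> powr (-1/2) * (1 / real J) powr (1/2 - \<epsilon>)))"
        unfolding eq[OF \<tau>] by (intro ennreal_leI bound)
    qed (rule \<tau>)
  qed
  show ?thesis
    unfolding Let_def using main by (intro exI[of _ 3]) auto
qed

end
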